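(* Let $X$ and $(X_n)_{n\ge 1}$ be i.i.d. real random variables defined on the same probability space, let $S_n:=X_1+\cdots+X_n$, and let $G$ be a moderate function. Then $(S_n/n)_{n\ge1}$ $G$-converges (to some real $x$) if and only if $|X|\,G(|X|)$ is integrable. More precisely, assume that $X$ is integrable and $E[X]=0$. Then the following assertions are equivalent: (a) $E[|X|\,G(|X|)]<\infty$; (b) for every $a>0$, $S(X,G,a):=\sum_{n\ge1} n^{-1}\,G(n)\,P[|S_n/n|\ge a]<\infty$; (c) for every $a>0$, $E[G(L_a^0)]<\infty$. Furthermore, if $G:[0,\infty)\to(0,\infty)$ is non decreasing and unbounded but not moderate, then assertions (a) and (c) are not equivalent, i.e. there exists an integrable centered random variable $X$ for which one of (a), (c) holds and the other does not.
   Context: A function $G$ defined on $[0,\infty)$ is called moderate if it is positive, non decreasing, increases to infinity, and $\sup_{t>0} G(2t)/G(t)<\infty$. For real random variables $(Y_n)_{n\ge1}$ on a common probability space, a real $x$ and $a>0$, set $L_a^x:=\sup\big(\{0\}\cup\{n\ge1:\ |Y_n-x|\ge a\}\big)$. For a non decreasing function $G$ increasing to infinity, $(Y_n)_n$ is said to $G$-converge to $x$ if $G(L_a^x)$ is integrable for every $a>0$; "$(Y_n)$ $G$-converges" means it $G$-converges to some $x$. In assertion (c), $L_a^0$ is computed for $Y_n=S_n/n$ and $x=0$. *)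

theory Defs
  imports "HOL-Probability.Probability"
begin

text \<open>Moderate functions on [0,\<infinity>) (values of G on negative reals are irrelevant).\<close>
definition moderate :: "(real \<Rightarrow> real) \<Rightarrow> bool" where
  "moderate G \<longleftrightarrow> (\<forall>t\<ge>0. G t > 0) \<and> mono_on {0..} G \<and> filterlim G at_top at_top
     \<and> (\<exists>C. \<forall>t>0. G (2 * t) / G t \<le> C)"

definition Lsup :: "(nat \<Rightarrow> 'a \<Rightarrow> real) \<Rightarrow> real \<Rightarrow> real \<Rightarrow> 'a \<Rightarrow> enat" where
  "Lsup Y x a \<omega> = Sup ({0} \<union> {enat n | n. n \<ge> 1 \<and> \<bar>Y n \<omega> - x\<bar> \<ge> a})"

definition Gext :: "(real \<Rightarrow> real) \<Rightarrow> enat \<Rightarrow> ennreal" where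
  "Gext G L = (case L of enat k \<Rightarrow> ennreal (G (real k)) | \<infinity> \<Rightarrow> \<infinity>)"

definition G_converges_to :: "'a measure \<Rightarrow> (real \<Rightarrow> real) \<Rightarrow> (nat \<Rightarrow> 'a \<Rightarrow> real) \<Rightarrow> real \<Rightarrow> bool" where
  "G_converges_to M G Y x \<longleftrightarrow> (\<forall>a>0.
      (\<lambda>\<omega>. Gext G (Lsup Y x a \<omega>)) \<in> borel_measurable M \<and>
      (\<integral>\<^sup>+ \<omega>. Gext G (Lsup Y x a \<omega>) \<partial>M) < \<infinity>)"

definition psum :: "(nat \<Rightarrow> 'a \<Rightarrow> real) \<Rightarrow> nat \<Rightarrow> 'a \<Rightarrow> real" where
  "psum Xs n \<omega> = (\<Sum>i\<in>{1..n}. Xs i \<omega>)"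

text \<open>X = Xs 0 and (X_n)_{n\<ge>1} = (Xs n)_{n\<ge>1} are i.i.d.\<close>
definition iid_seq :: "'a measure \<Rightarrow> (nat \<Rightarrow> 'a \<Rightarrow> real) \<Rightarrow> bool" where
  "iid_seq M Xs \<longleftrightarrow> prob_space.indep_vars M (\<lambda>_. borel) Xs UNIV \<and>
      (\<forall>n. distr M borel (Xs n) = distr M borel (Xs 0))"

end

theory Submission
  imports Defs
begin

text \<open>
  The cycle (a) \<open>\<Longrightarrow>\<close> (b) \<open>\<Longrightarrow>\<close> (c) \<open>\<Longrightarrow>\<close> (a) is proved for centered variables, and the case of a general
  limit \<open>x\<close> follows by translation.

  (a) \<open>\<Longrightarrow>\<close> (b): truncate at level \<open>b n\<close>. A Chernoff bound gives
  \<open>P[\<bar>S\<^sub>n\<bar> \<ge> a n] \<le> 2 n P[\<bar>X\<bar> > b n] + C (E[X\<^sup>2; \<bar>X\<bar> \<le> b n] / n)\<^sup>r\<close>, and Jensen's inequality bounds the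
  last term by a multiple of \<open>n\<^bsup>-r\<^esup> E[\<bar>X\<bar>\<^bsup>r+1\<^esup>; \<bar>X\<bar> \<le> n]\<close>. As a moderate \<open>G\<close> grows at most like a power
  \<open>p\<close>, both parts sum, with \<open>r = p + 1\<close>, to a multiple of \<open>E[\<bar>X\<bar> G(\<bar>X\<bar>)]\<close>.

  (b) \<open>\<Longrightarrow>\<close> (c): by Ottaviani's inequality and the weak law, \<open>\<bar>S\<^sub>j\<bar> \<ge> a j\<close> for some \<open>j\<close> in a dyadic block has
  probability at most \<open>2 P[\<bar>S\<^sub>n\<bar> \<ge> a n / 8]\<close> for each \<open>n\<close> in the next block.

  (c) \<open>\<Longrightarrow>\<close> (a): \<open>\<bar>X\<^sub>n\<bar> \<ge> 2 a n\<close> implies \<open>L \<ge> n - 1\<close>, so independence bounds the tails of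
  \<open>\<Sum>n. P[\<bar>X\<bar> \<ge> 2 a n]\<close> by \<open>2 P[L \<ge> m]\<close>. For every non decreasing unbounded \<open>H\<close> this yields
  \<open>E[\<bar>X\<bar> H(2 \<bar>X\<bar>)] < \<infinity>\<close> when \<open>a = 1 / 8\<close>. If \<open>H\<close> is not moderate there are \<open>t\<^sub>k\<close> with
  \<open>H(2 t\<^sub>k) \<ge> 2\<^sup>k H(t\<^sub>k)\<close>, and a symmetric variable supported on \<open>0\<close> and the \<open>\<plusminus>t\<^sub>k\<close> with
  \<open>E[\<bar>X\<bar> H(\<bar>X\<bar>)] < \<infinity> = E[\<bar>X\<bar> H(2 \<bar>X\<bar>)]\<close> satisfies (a) but not (c).
\<close>

section \<open>Increments of a weight function\<close>

text \<open>Jumps of \<open>H\<close> along the integers. Counting \<open>H 0\<close> as the jump at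
  0 lets the partial sums telescope to \<open>H k\<close> with no remainder, so that
  \<open>E[H(L)]\<close> becomes a weighted sum of the probabilities
  \<open>P(L >= m)\<close>.\<close>

definition incr :: "(real \<Rightarrow> real) \<Rightarrow> nat \<Rightarrow> real" where
  "incr H m = (if m = 0 then H 0 else H (real m) - H (real (m - 1)))"

lemma sum_incr: "(\<Sum>m\<le>k. incr H m) = H (real k)"
  by (induction k) (simp_all add: incr_def)

lemma incr_nonneg:
  assumes "\<forall>t\<ge>0. H t > 0" "mono_on {0..} H"
  shows "incr H m \<ge> 0"
  using assms by (auto simp: incr_def less_imp_le intro!: mono_onD[of "{0..}" H])

text \<open>Tonelli's theorem, with one of the two series read as an integral against counting
  measure.\<close>

lemma suminf_swap:
  fixes f :: "nat \<Rightarrow> nat \<Rightarrow> ennreal"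
  shows "(\<Sum>i. \<Sum>j. f i j) = (\<Sum>j. \<Sum>i. f i j)"
  using nn_integral_suminf[of "\<lambda>j i. f i j" "count_space UNIV"]
  by (simp add: nn_integral_count_space_nat)

lemma suminf_indicator_atMost:
  fixes f :: "nat \<Rightarrow> ennreal"
  shows "(\<Sum>m. f m * indicator {..k} m) = (\<Sum>m\<le>k. f m)"
  by (subst suminf_finite[where N = "{..k}"]) auto

lemma suminf_indicator_lessThan:
  fixes f :: "nat \<Rightarrow> ennreal"
  shows "(\<Sum>m. f m * indicator {..<k} m) = (\<Sum>m<k. f m)"
  by (subst suminf_finite[where N = "{..<k}"]) auto

text \<open>Layer-cake form of \<open>H(L)\<close>: the jumps up to a finite \<open>L\<close>
  telescope. For infinite \<open>L\<close> both sides are infinite, since convergence of the series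
  of jumps would bound \<open>H\<close> along the integers.\<close>

lemma Gext_eq_suminf:
  assumes H: "\<forall>t\<ge>0. H t > 0" "mono_on {0..} H" "filterlim H at_top at_top"
  shows "Gext H L = (\<Sum>m. ennreal (incr H m) * indicator {m. enat m \<le> L} m)"
proof (cases L)
  case (enat k)
  then have "{m. enat m \<le> L} = {..k}" by auto
  then show ?thesis
    using enat
    by (simp add: suminf_indicator_atMost incr_nonneg[OF H(1,2)] sum_incr Gext_def del: ennreal_suminf_multc)
next
  case infinity
  have "\<not> summable (incr H)"
  proof
    assume s: "summable (incr H)"
    have "(\<lambda>k. \<Sum>m\<le>k. incr H m) \<longlonglongrightarrow> suminf (incr H)"
      using s summable_LIMSEQ' by blast
    then have "(\<lambda>k. H (real k)) \<longlonglongrightarrow> suminf (incr H)" by (simp add: sum_incr)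
    moreover have "filterlim (\<lambda>k. H (real k)) at_top sequentially"
      using H(3) filterlim_real_sequentially filterlim_compose by blast
    ultimately show False
      using not_tendsto_and_filterlim_at_infinity[OF sequentially_bot] filterlim_at_top_imp_at_infinity
      by blast
  qed
  then have "(\<Sum>m. ennreal (incr H m)) = top"
    using incr_nonneg[OF H(1,2)] summable_iff_suminf_neq_top by blast
  then show ?thesis using infinity by (simp add: Gext_def)
qed

text \<open>Rewrites \<open>L >= m\<close> as a countable union of events on single indices, the
  form behind measurability and the tail estimates. The case \<open>m = 0\<close> comes from the
  \<open>0\<close> in the supremum.\<close>

lemma enat_le_Lsup_iff:
  "enat m \<le> Lsup Y x a \<omega> \<longleftrightarrow> m = 0 \<or> (\<exists>n\<ge>m. n \<ge> 1 \<and> \<bar>Y n \<omega> - x\<bar> \<ge> a)"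
proof
  assume L: "enat m \<le> Lsup Y x a \<omega>"
  show "m = 0 \<or> (\<exists>n\<ge>m. n \<ge> 1 \<and> \<bar>Y n \<omega> - x\<bar> \<ge> a)"
  proof (rule ccontr)
    assume "\<not> ?thesis"
    then have m: "m > 0" and n: "\<And>n. n \<ge> 1 \<Longrightarrow> \<bar>Y n \<omega> - x\<bar> \<ge> a \<Longrightarrow> n < m"
      by (auto simp del: not_le intro!: not_le_imp_less)
    have "Lsup Y x a \<omega> \<le> enat (m - 1)"
      unfolding Lsup_def
    proof (intro Sup_least)
      fix z assume "z \<in> {0} \<union> {enat n |n. n \<ge> 1 \<and> \<bar>Y n \<omega> - x\<bar> \<ge> a}"
      then consider "z = 0" | k where "z = enat k" "k \<ge> 1" "\<bar>Y k \<omega> - x\<bar> \<ge> a" by blast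
      then show "z \<le> enat (m - 1)"
      proof cases
        case 2
        then show ?thesis using n[of k] by simp
      qed simp
    qed
    with L m show False by (metis diff_less enat_ord_simps(1) leD order_trans zero_less_one)
  qed
next
  assume "m = 0 \<or> (\<exists>n\<ge>m. n \<ge> 1 \<and> \<bar>Y n \<omega> - x\<bar> \<ge> a)"
  then show "enat m \<le> Lsup Y x a \<omega>"
  proof
    assume "\<exists>n\<ge>m. n \<ge> 1 \<and> \<bar>Y n \<omega> - x\<bar> \<ge> a"
    then obtain n where "n \<ge> m" "n \<ge> 1" "\<bar>Y n \<omega> - x\<bar> \<ge> a" by blast
    then show ?thesis unfolding Lsup_def
      by (intro Sup_upper2[of "enat n"]) auto
  qed (simp add: zero_enat_def[symmetric])
qed

section \<open>Moderate functions\<close>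

text \<open>Clears the denominator in the ratio bound. Taking \<open>max C 1\<close> also covers
  \<open>t = 0\<close>, where the inequality reads \<open>G 0 <= C * G 0\<close>.\<close>

lemma moderate_doubling:
  assumes "moderate G"
  obtains C where "C \<ge> 1" "\<And>t. t \<ge> 0 \<Longrightarrow> G (2 * t) \<le> C * G t"
proof -
  from assms obtain C where C: "\<forall>t>0. G (2 * t) / G t \<le> C" and p: "\<forall>t\<ge>0. G t > 0"
    by (auto simp: moderate_def)
  show ?thesis
  proof (rule that[of "max C 1"])
    fix t :: real assume t: "t \<ge> 0"
    show "G (2 * t) \<le> max C 1 * G t"
    proof (cases "t = 0")
      case True
      then show ?thesis using p by (simp add: max_def)
    next
      case False
      with t have "G (2 * t) \<le> C * G t" using C p by (simp add: divide_simps split: if_splits)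
      also have "\<dots> \<le> max C 1 * G t" using p t by (intro mult_right_mono) (auto simp: less_imp_le)
      finally show ?thesis .
    qed
  qed simp
qed

text \<open>Iterated doubling, by induction on the number \<open>j\<close> of doublings that lead
  from \<open>t\<close> past \<open>s\<close>. The exponent satisfies \<open>C <= 2 ^ p\<close>, so
  each halving of \<open>s\<close> costs the factor \<open>C / 2 ^ p <= 1\<close> and the constant
  does not grow.\<close>

lemma moderate_polynomial_growth:
  assumes "moderate G"
  obtains C p where "C \<ge> 1" "p \<ge> 1"
    "\<And>s t. 0 < t \<Longrightarrow> t \<le> s \<Longrightarrow> G s \<le> C * (s / t) ^ p * G t"
proof -
  from assms have pos: "\<And>t. t \<ge> 0 \<Longrightarrow> G t > 0" and mono: "mono_on {0..} G"
    by (auto simp: moderate_def)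
  obtain C where C: "C \<ge> 1" "\<And>t. t \<ge> 0 \<Longrightarrow> G (2 * t) \<le> C * G t"
    using moderate_doubling[OF assms] by metis
  obtain p0 where p0: "C < 2 ^ p0" using real_arch_pow[of 2 C] by auto
  define p where "p = Suc p0"
  have p: "C \<le> 2 ^ p" "p \<ge> 1" using p0 by (auto simp: p_def intro: order_trans[of C "2 ^ p0"])
  have *: "0 < t \<Longrightarrow> t \<le> s \<Longrightarrow> s \<le> 2 ^ j * t \<Longrightarrow> G s \<le> C * (s / t) ^ p * G t" for s t j
  proof (induction j arbitrary: s)
    case 0
    then have "s = t" by simp
    then show ?case using C(1) pos[of t] 0 by simp
  next
    case (Suc j)
    show ?case
    proof (cases "s \<le> 2 * t")
      case True
      have "G s \<le> G (2 * t)" using True Suc.prems by (intro mono_onD[OF mono]) auto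
      also have "\<dots> \<le> C * G t" using C(2)[of t] Suc.prems by simp
      also have "\<dots> \<le> C * (s / t) ^ p * G t"
      proof -
        have "1 \<le> (s / t) ^ p" using Suc.prems by (intro one_le_power) simp
        then have "C * 1 \<le> C * (s / t) ^ p" using C(1) by (intro mult_left_mono) auto
        then show ?thesis using pos[of t] Suc.prems by (intro mult_right_mono) auto
      qed
      finally show ?thesis .
    next
      case False
      have "G s \<le> C * G (s / 2)" using C(2)[of "s / 2"] Suc.prems by simp
      also have "\<dots> \<le> C * (C * ((s / 2) / t) ^ p * G t)"
        using Suc.IH[of "s / 2"] Suc.prems False C(1) by (intro mult_left_mono) auto
      also have "\<dots> = (C / 2 ^ p) * (C * (s / t) ^ p * G t)"
        by (simp add: power_divide)
      also have "\<dots> \<le> 1 * (C * (s / t) ^ p * G t)"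
        using p C(1) pos[of t] Suc.prems by (intro mult_right_mono) (auto simp: divide_simps less_imp_le)
      finally show ?thesis by simp
    qed
  qed
  show ?thesis
  proof (rule that[of C p])
    fix s t :: real assume st: "0 < t" "t \<le> s"
    obtain j where "s / t < 2 ^ j" using real_arch_pow[of 2 "s / t"] by auto
    then have "s \<le> 2 ^ j * t" using st by (simp add: field_simps)
    then show "G s \<le> C * (s / t) ^ p * G t" using *[of t s j] st by blast
  qed (use C p in auto)
qed

text \<open>Since \<open>|u + v| <= 2 max(|u|, |v|)\<close>, one doubling suffices. This lets the
  moment condition pass from \<open>X\<close> to its translates by constants.\<close>

lemma times_moderate_add_le:
  assumes "moderate G"
  obtains C where "C \<ge> 0" "\<And>u v. \<bar>u + v\<bar> * G \<bar>u + v\<bar> \<le> C * (\<bar>u\<bar> * G \<bar>u\<bar> + \<bar>v\<bar> * G \<bar>v\<bar>)"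
proof -
  from assms have pos: "\<And>t. t \<ge> 0 \<Longrightarrow> G t > 0" and mono: "mono_on {0..} G"
    by (auto simp: moderate_def)
  obtain C where C: "C \<ge> 1" "\<And>t. t \<ge> 0 \<Longrightarrow> G (2 * t) \<le> C * G t"
    using moderate_doubling[OF assms] by metis
  show ?thesis
  proof (rule that[of "2 * C"])
    fix u v :: real
    define m where "m = max \<bar>u\<bar> \<bar>v\<bar>"
    have m: "m \<ge> 0" "\<bar>u + v\<bar> \<le> 2 * m" by (auto simp: m_def)
    have "\<bar>u + v\<bar> * G \<bar>u + v\<bar> \<le> (2 * m) * G (2 * m)"
      using m pos by (intro mult_mono mono_onD[OF mono]) (auto simp: less_imp_le)
    also have "\<dots> \<le> (2 * m) * (C * G m)"
      using m C by (intro mult_left_mono) auto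
    also have "\<dots> = 2 * C * (m * G m)" by simp
    also have "m * G m \<le> \<bar>u\<bar> * G \<bar>u\<bar> + \<bar>v\<bar> * G \<bar>v\<bar>"
      using pos[of "\<bar>u\<bar>"] pos[of "\<bar>v\<bar>"] by (auto simp: m_def max_def less_imp_le)
    finally show "\<bar>u + v\<bar> * G \<bar>u + v\<bar> \<le> 2 * C * (\<bar>u\<bar> * G \<bar>u\<bar> + \<bar>v\<bar> * G \<bar>v\<bar>)"
      using C by simp
  qed (use C in auto)
qed

section \<open>Elementary estimates for series, monotone functions and exponentials\<close>

text \<open>Comparison with the telescoping differences \<open>1 / N - 1 / (N + 1)\<close>. The 2
  pays for the first index beyond \<open>t\<close>, whose term is only bounded by
  \<open>1 / (N + 1)\<close>.\<close>

lemma suminf_inverse_square_ge_le: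
  fixes t :: real
  assumes "t > 0"
  shows "(\<Sum>k. ennreal (1 / real (Suc k) ^ 2) * indicator {k. t \<le> real (Suc k)} k) \<le> ennreal (2 / t)"
proof (rule suminf_le_const)
  fix N
  define f where "f k = 1 / real (Suc k) ^ 2 * indicator {k. t \<le> real (Suc k)} k" for k
  \<comment> \<open>Subtracting \<open>1 / max t N\<close> strengthens the claim enough for
    induction: the correction stays constant until \<open>N\<close> passes \<open>t\<close> and
    telescopes afterwards.\<close>
  have bound: "(\<Sum>k<N. f k) \<le> 2 / t - 1 / max t (real N) " for N
  proof (induction N)
    case 0
    then show ?case using assms by (simp add: max_def divide_right_mono)
  next
    case (Suc N)
    show ?case
    proof (cases "t \<le> real (Suc N)")
      case False
      then have "max t (real (Suc N)) = t" "max t (real N) = t" by auto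
      then show ?thesis using False Suc by (simp add: f_def)
    next
      case True
      show ?thesis
      proof (cases "t \<le> real N")
        case True2: True
        then have N: "real N > 0" using assms by linarith
        have "f N \<le> 1 / real N - 1 / real (Suc N)"
        proof -
          have "1 / real (Suc N) ^ 2 \<le> 1 / (real N * real (Suc N))"
            using N by (intro divide_left_mono) (auto simp: power2_eq_square)
          also have "\<dots> = 1 / real N - 1 / real (Suc N)" using N by (simp add: field_simps)
          finally show ?thesis using True by (simp add: f_def)
        qed
        moreover have "max t (real (Suc N)) = real (Suc N)" "max t (real N) = real N"
          using True True2 by (simp_all add: max_def)
        ultimately show ?thesis using Suc by simp
      next
        case False
        have "(\<Sum>k<N. f k) = 0" using False by (intro sum.neutral) (auto simp: f_def indicator_def)
        moreover have "f N \<le> 1 / real (Suc N)"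
          using True by (simp add: f_def power2_eq_square divide_simps)
        moreover have "max t (real (Suc N)) = real (Suc N)" using True by (simp add: max_def)
        moreover have "1 / real (Suc N) \<le> 1 / t" using True assms by (intro divide_left_mono) auto
        ultimately show ?thesis by simp
      qed
    qed
  qed
  have "ennreal (1 / real (Suc k) ^ 2) * indicator {k. t \<le> real (Suc k)} k = ennreal (f k)" for k
    by (simp add: f_def indicator_def)
  moreover have "f k \<ge> 0" for k by (simp add: f_def)
  ultimately have "(\<Sum>k<N. ennreal (1 / real (Suc k) ^ 2) * indicator {k. t \<le> real (Suc k)} k) = ennreal (\<Sum>k<N. f k)"
    by (simp only: sum_ennreal)
  also have "\<dots> \<le> ennreal (2 / t)"
  proof (rule ennreal_leI)
    have "(\<Sum>k<N. f k) \<le> 2 / t - 1 / max t (real N)" by (rule bound)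
    also have "\<dots> \<le> 2 / t" using assms by simp
    finally show "(\<Sum>k<N. f k) \<le> 2 / t" .
  qed
  finally show "(\<Sum>k<N. ennreal (1 / real (Suc k) ^ 2) * indicator {k. t \<le> real (Suc k)} k) \<le> ennreal (2 / t)" .
qed simp

text \<open>Monotonicity is known only on nonnegative arguments, so \<open>H\<close> is composed
  with \<open>max 0\<close>, which makes it monotone on the whole line and therefore Borel.\<close>

lemma measurable_mono_on_nonneg:
  assumes "mono_on {0..} H" "f \<in> borel_measurable M" "\<And>\<omega>. f \<omega> \<ge> 0"
  shows "(\<lambda>\<omega>. H (f \<omega> :: real) :: real) \<in> borel_measurable M"
proof -
  have "mono (\<lambda>x. H (max 0 x))"
    by (intro monoI mono_onD[OF assms(1)]) auto
  then have "(\<lambda>x. H (max 0 x)) \<in> borel_measurable borel"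
    by (rule borel_measurable_mono)
  from measurable_compose[OF assms(2) this] show ?thesis
    using assms(3) by (simp add: max_def)
qed

text \<open>Linearises the lower bound \<open>1 - exp (- s)\<close> for the probability of a union
  of independent events. The hypothesis forces \<open>s <= 1\<close>, and there
  \<open>1 - exp (- s) >= s / (1 + s) >= s / 2\<close>.\<close>

lemma one_minus_exp_ge_half:
  fixes s :: real
  assumes "s \<ge> 0" "1 - exp (- s) \<le> 1 / 2"
  shows "s \<le> 2 * (1 - exp (- s))"
proof -
  have "s \<le> 1"
  proof (rule ccontr)
    assume "\<not> s \<le> 1"
    then have "exp (- s) \<le> exp (- 1)" by simp
    \<comment> \<open>From \<open>exp 1 >= (1 + 1 / 2) ^ 2 = 9 / 4\<close>.\<close>
    moreover have "exp (- 1 :: real) < 1 / 2"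
      using exp_ge_one_plus_x_over_n_power_n[of 2 1] by (simp add: exp_minus divide_simps power2_eq_square)
    ultimately show False using assms by linarith
  qed
  have "exp (- s) \<le> 1 / (1 + s)"
    using exp_ge_add_one_self[of s] assms by (simp add: exp_minus divide_simps)
  then have "1 - exp (- s) \<ge> s / (1 + s)" using assms by (simp add: field_simps)
  moreover have "s / (1 + s) \<ge> s / 2" using assms \<open>s \<le> 1\<close> by (intro divide_left_mono) auto
  ultimately have "s / 2 \<le> 1 - exp (- s)" by (rule order_trans[rotated])
  then show ?thesis by simp
qed

lemma suminf_Suc_le:
  fixes f :: "nat \<Rightarrow> ennreal"
  shows "(\<Sum>n. f (Suc n)) \<le> (\<Sum>n. f n)"
proof (rule suminf_le_const)
  fix N
  have "(\<Sum>n<N. f (Suc n)) = (\<Sum>n\<in>Suc ` {..<N}. f n)" by (simp add: sum.reindex)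
  also have "\<dots> \<le> (\<Sum>n. f n)" by (intro sum_le_suminf) auto
  finally show "(\<Sum>n<N. f (Suc n)) \<le> (\<Sum>n. f n)" .
qed simp

section \<open>Integrals of the last exit time\<close>

lemma sets_le_Lsup:
  assumes [measurable]: "\<And>n. Y n \<in> borel_measurable M"
  shows "{\<omega> \<in> space M. enat m \<le> Lsup Y x a \<omega>} \<in> sets M"
  unfolding enat_le_Lsup_iff by measurable

lemma measurable_Gext_Lsup:
  assumes H: "\<forall>t\<ge>0. H t > 0" "mono_on {0..} H" "filterlim H at_top at_top"
  assumes [measurable]: "\<And>n. Y n \<in> borel_measurable M"
  shows "(\<lambda>\<omega>. Gext H (Lsup Y x a \<omega>)) \<in> borel_measurable M"
  unfolding Gext_eq_suminf[OF H] indicator_def mem_Collect_eq enat_le_Lsup_iff by measurable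

text \<open>Integrating the layer-cake series term by term expresses \<open>E[H(L)]\<close> through
  the tails of \<open>L\<close>; upper and lower estimates of \<open>E[H(L)]\<close> both start
  here.\<close>

lemma nn_integral_Gext_Lsup:
  assumes H: "\<forall>t\<ge>0. H t > 0" "mono_on {0..} H" "filterlim H at_top at_top"
  assumes Y: "\<And>n. Y n \<in> borel_measurable M"
  shows "(\<integral>\<^sup>+\<omega>. Gext H (Lsup Y x a \<omega>) \<partial>M) =
    (\<Sum>m. ennreal (incr H m) * emeasure M {\<omega> \<in> space M. enat m \<le> Lsup Y x a \<omega>})"
proof -
  note [measurable] = sets_le_Lsup[OF Y]
  have "(\<integral>\<^sup>+\<omega>. Gext H (Lsup Y x a \<omega>) \<partial>M) =
    (\<integral>\<^sup>+\<omega>. (\<Sum>m. ennreal (incr H m) * indicator {\<omega> \<in> space M. enat m \<le> Lsup Y x a \<omega>} \<omega>) \<partial>M)"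
    unfolding Gext_eq_suminf[OF H] by (intro nn_integral_cong suminf_cong) (auto simp: indicator_def)
  also have "\<dots> = (\<Sum>m. ennreal (incr H m) * emeasure M {\<omega> \<in> space M. enat m \<le> Lsup Y x a \<omega>})"
    by (subst nn_integral_suminf) (auto simp: nn_integral_cmult_indicator intro!: suminf_cong)
  finally show ?thesis .
qed

locale iid_rv = prob_space M for M :: "'a measure" +
  fixes X :: "nat \<Rightarrow> 'a \<Rightarrow> real"
  assumes iid: "iid_seq M X"
begin

lemma indep_X: "indep_vars (\<lambda>_. borel) X UNIV"
  using iid by (simp add: iid_seq_def)

lemma measurable_X [measurable]: "X n \<in> borel_measurable M"
  using indep_X by (simp add: indep_vars_def)

lemma measurable_psum [measurable]: "psum X n \<in> borel_measurable M"
  unfolding psum_def by measurable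

lemma distr_X: "distr M borel (X n) = distr M borel (X 0)"
  using iid by (simp add: iid_seq_def)

lemma prob_X:
  assumes "{x. P x} \<in> sets borel"
  shows "prob {\<omega> \<in> space M. P (X n \<omega>)} = prob {\<omega> \<in> space M. P (X 0 \<omega>)}"
proof -
  have "prob {\<omega> \<in> space M. P (X k \<omega>)} = measure (distr M borel (X k)) {x. P x}" for k
    by (subst measure_distr) (auto simp: assms intro!: arg_cong[where f = prob])
  then show ?thesis using distr_X[of n] by simp
qed

lemma iid_seq_compose:
  assumes [measurable]: "f \<in> borel_measurable borel"
  shows "iid_seq M (\<lambda>n \<omega>. f (X n \<omega>))"
proof -
  have "indep_vars (\<lambda>_. borel) (\<lambda>n \<omega>. f (X n \<omega>)) UNIV"
    by (rule indep_vars_compose2[OF indep_X]) simp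
  moreover have "distr M borel (\<lambda>\<omega>. f (X n \<omega>)) = distr (distr M borel (X n)) borel f" for n
    by (subst distr_distr) (auto simp: comp_def)
  ultimately show ?thesis using distr_X by (metis iid_seq_def)
qed

lemma iid_rv_compose:
  assumes "f \<in> borel_measurable borel"
  shows "iid_rv M (\<lambda>n \<omega>. f (X n \<omega>))"
  using iid_seq_compose[OF assms] by unfold_locales

section \<open>From the last exit time to the moment condition\<close>

text \<open>A quantitative second Borel-Cantelli lemma: by independence the complement has as
  probability the product of the \<open>1 - q n\<close>, each at most
  \<open>exp (- q n)\<close>.\<close>

lemma prob_ex_abs_ge:
  assumes "finite J"
  shows "1 - exp (- (\<Sum>n\<in>J. prob {\<omega> \<in> space M. b n \<le> \<bar>X 0 \<omega>\<bar>}))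
    \<le> prob {\<omega> \<in> space M. \<exists>n\<in>J. b n \<le> \<bar>X n \<omega>\<bar>}"
proof (cases "J = {}")
  case False
  define q where "q n = prob {\<omega> \<in> space M. b n \<le> \<bar>X 0 \<omega>\<bar>}" for n
  have q: "prob (X n -` {x. \<not> b n \<le> \<bar>x\<bar>} \<inter> space M) = 1 - q n" for n
  proof -
    have "X n -` {x. \<not> b n \<le> \<bar>x\<bar>} \<inter> space M = space M - {\<omega> \<in> space M. b n \<le> \<bar>X n \<omega>\<bar>}" by auto
    then have "prob (X n -` {x. \<not> b n \<le> \<bar>x\<bar>} \<inter> space M) = 1 - prob {\<omega> \<in> space M. b n \<le> \<bar>X n \<omega>\<bar>}"
      by (simp add: prob_compl)
    also have "prob {\<omega> \<in> space M. b n \<le> \<bar>X n \<omega>\<bar>} = q n"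
      unfolding q_def by (rule prob_X) measurable
    finally show ?thesis .
  qed
  have "{\<omega> \<in> space M. \<exists>n\<in>J. b n \<le> \<bar>X n \<omega>\<bar>} =
    space M - (\<Inter>n\<in>J. X n -` {x. \<not> b n \<le> \<bar>x\<bar>} \<inter> space M)" using False by auto
  moreover have "(\<Inter>n\<in>J. X n -` {x. \<not> b n \<le> \<bar>x\<bar>} \<inter> space M) \<in> events"
    using False assms by (intro sets.finite_INT) auto
  ultimately have eq: "prob {\<omega> \<in> space M. \<exists>n\<in>J. b n \<le> \<bar>X n \<omega>\<bar>} =
    1 - prob (\<Inter>n\<in>J. X n -` {x. \<not> b n \<le> \<bar>x\<bar>} \<inter> space M)"
    by (simp add: prob_compl)
  have "prob (\<Inter>n\<in>J. X n -` {x. \<not> b n \<le> \<bar>x\<bar>} \<inter> space M) =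
    (\<Prod>n\<in>J. prob (X n -` {x. \<not> b n \<le> \<bar>x\<bar>} \<inter> space M))"
    using False assms by (intro indep_varsD[OF indep_X]) (auto simp: not_le)
  also have "\<dots> = (\<Prod>n\<in>J. 1 - q n)" by (simp only: q)
  also have "\<dots> \<le> (\<Prod>n\<in>J. exp (- q n))"
    using exp_ge_add_one_self[of "- q _"] by (intro prod_mono) (auto simp: q_def)
  also have "\<dots> = exp (- (\<Sum>n\<in>J. q n))" using assms by (simp add: exp_sum[symmetric] sum_negf)
  finally show ?thesis unfolding eq by (simp add: q_def)
qed simp

text \<open>A summand of size \<open>2 a n\<close> forces \<open>\<bar>S\<^sub>n\<bar> \<ge> a n\<close> or \<open>\<bar>S\<^bsub>n-1\<^esub>\<bar> \<ge> a n\<close>,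
  so no moment or centering assumption is involved here.\<close>

lemma abs_ge_imp_le_Lsup:
  assumes "a > 0" "n > m" "2 * a * real n \<le> \<bar>X n \<omega>\<bar>"
  shows "enat m \<le> Lsup (\<lambda>n \<omega>. psum X n \<omega> / real n) 0 a \<omega>"
proof -
  have "psum X n \<omega> = X n \<omega> + psum X (n - 1) \<omega>"
    using assms(2) by (cases n) (auto simp: psum_def)
  with assms have "a * real n \<le> \<bar>psum X n \<omega>\<bar> \<or> a * real n \<le> \<bar>psum X (n - 1) \<omega>\<bar>" by linarith
  then show ?thesis
  proof
    assume "a * real n \<le> \<bar>psum X n \<omega>\<bar>"
    then show ?thesis unfolding enat_le_Lsup_iff
      using assms by (intro disjI2 exI[of _ n]) (auto simp: field_simps)
  next
    assume *: "a * real n \<le> \<bar>psum X (n - 1) \<omega>\<bar>"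
    have "a * real (n - 1) \<le> a * real n" using assms by simp
    with * have "a * real (n - 1) \<le> \<bar>psum X (n - 1) \<omega>\<bar>" by linarith
    \<comment> \<open>For \<open>m = 0\<close> nothing is to be shown; otherwise
      \<open>n - 1 >= m >= 1\<close>, so \<open>n - 1\<close> is an admissible index.\<close>
    then show ?thesis unfolding enat_le_Lsup_iff
      using assms by (cases "m = 0") (auto simp: field_simps intro!: exI[of _ "n - 1"])
  qed
qed

text \<open>Any partial sum \<open>s\<close> satisfies
  \<open>1 - exp (- s) <= P(L >= m) <= 1 / 2\<close> by independence, and in this range
  \<open>s\<close> is at most twice the left-hand side.\<close>

lemma suminf_tail_le_prob_Lsup:
  assumes a: "a > 0"
    and half: "prob {\<omega> \<in> space M. enat m \<le> Lsup (\<lambda>n \<omega>. psum X n \<omega> / real n) 0 a \<omega>} \<le> 1 / 2"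
  shows "(\<Sum>n. ennreal (prob {\<omega> \<in> space M. 2 * a * real n \<le> \<bar>X 0 \<omega>\<bar>}) * indicator {m<..} n)
    \<le> 2 * emeasure M {\<omega> \<in> space M. enat m \<le> Lsup (\<lambda>n \<omega>. psum X n \<omega> / real n) 0 a \<omega>}"
    (is "(\<Sum>n. ennreal (?q n) * _) \<le> 2 * emeasure M ?E")
proof (rule suminf_le_const)
  fix N
  have E: "?E \<in> events" by (rule sets_le_Lsup) measurable
  define J where "J = {n. m < n \<and> n < N}"
  define s where "s = (\<Sum>n\<in>J. ?q n)"
  have J: "finite J" by (simp add: J_def)
  have "1 - exp (- s) \<le> prob {\<omega> \<in> space M. \<exists>n\<in>J. 2 * a * real n \<le> \<bar>X n \<omega>\<bar>}"
    unfolding s_def by (rule prob_ex_abs_ge[OF J])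
  also have "\<dots> \<le> prob ?E"
    using abs_ge_imp_le_Lsup[OF a] by (intro finite_measure_mono E) (auto simp: J_def)
  finally have le: "1 - exp (- s) \<le> prob ?E" .
  have "s \<le> 2 * (1 - exp (- s))"
    using le half by (intro one_minus_exp_ge_half) (auto simp: s_def intro!: sum_nonneg)
  also have "\<dots> \<le> 2 * prob ?E" using le by simp
  finally have "s \<le> 2 * prob ?E" .
  have "(\<Sum>n<N. ennreal (?q n) * indicator {m<..} n) = (\<Sum>n\<in>J. ennreal (?q n))"
    by (intro sum.mono_neutral_cong_right) (auto simp: J_def indicator_def split: if_splits)
  also have "\<dots> = ennreal s" by (simp add: s_def)
  also have "\<dots> \<le> ennreal (2 * prob ?E)" using \<open>s \<le> 2 * prob ?E\<close> by (rule ennreal_leI)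
  also have "\<dots> = 2 * emeasure M ?E" by (simp add: emeasure_eq_measure ennreal_mult)
  finally show "(\<Sum>n<N. ennreal (?q n) * indicator {m<..} n) \<le> 2 * emeasure M ?E" .
qed simp

text \<open>Writing \<open>H j\<close> as a sum of jumps turns the series into the sum of the jumps
  at \<open>m\<close> times the tail sums \<open>T m\<close>. For large \<open>m\<close> Markov's
  inequality gives \<open>P(L >= m) <= 1 / 2\<close>, hence \<open>T m <= 2 P(L >= m)\<close>, and
  the layer-cake series of \<open>E[H(L)]\<close> dominates.\<close>

lemma suminf_tails_finite:
  assumes H: "\<forall>t\<ge>0. H t > 0" "mono_on {0..} H" "filterlim H at_top at_top" and a: "a > 0"
    and fin: "(\<integral>\<^sup>+\<omega>. Gext H (Lsup (\<lambda>n \<omega>. psum X n \<omega> / real n) 0 a \<omega>) \<partial>M) < \<infinity>"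
  shows "(\<Sum>j. ennreal (H (real j)) * ennreal (prob {\<omega> \<in> space M. 2 * a * real (Suc j) \<le> \<bar>X 0 \<omega>\<bar>})) < \<infinity>"
proof -
  define q where "q n = prob {\<omega> \<in> space M. 2 * a * real n \<le> \<bar>X 0 \<omega>\<bar>}" for n
  define E where "E m = {\<omega> \<in> space M. enat m \<le> Lsup (\<lambda>n \<omega>. psum X n \<omega> / real n) 0 a \<omega>}" for m
  define T where "T m = (\<Sum>n. ennreal (q n) * indicator {m<..} n)" for m
  have E: "E m \<in> events" for m unfolding E_def by (rule sets_le_Lsup) measurable
  have Y: "(\<lambda>\<omega>. psum X n \<omega> / real n) \<in> borel_measurable M" for n by measurable
  have int: "(\<integral>\<^sup>+\<omega>. Gext H (Lsup (\<lambda>n \<omega>. psum X n \<omega> / real n) 0 a \<omega>) \<partial>M) =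
      (\<Sum>m. ennreal (incr H m) * emeasure M (E m))"
    unfolding E_def by (rule nn_integral_Gext_Lsup[OF H Y])
  note nonneg = incr_nonneg[OF H(1,2)]
  \<comment> \<open>Markov's inequality, read off from the layer-cake series because the events
    \<open>E m\<close> decrease.\<close>
  have Hm: "ennreal (H (real m)) * emeasure M (E m) \<le> (\<Sum>m. ennreal (incr H m) * emeasure M (E m))" for m
  proof -
    have "ennreal (H (real m)) * emeasure M (E m) = (\<Sum>k\<le>m. ennreal (incr H k) * emeasure M (E m))"
      by (simp add: sum_distrib_right[symmetric] nonneg sum_incr)
    also have "\<dots> \<le> (\<Sum>k\<le>m. ennreal (incr H k) * emeasure M (E k))"
    proof (intro sum_mono mult_left_mono emeasure_mono)
      fix k assume "k \<in> {..m}"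
      then have "enat k \<le> enat m" by simp
      then show "E m \<subseteq> E k" unfolding E_def by (auto intro: order_trans[of _ "enat m"])
    qed (use E in auto)
    also have "\<dots> \<le> (\<Sum>m. ennreal (incr H m) * emeasure M (E m))"
      by (intro sum_le_suminf) auto
    finally show ?thesis .
  qed
  define c where "c = enn2real (\<Sum>m. ennreal (incr H m) * emeasure M (E m))"
  have c: "ennreal c = (\<Sum>m. ennreal (incr H m) * emeasure M (E m))" "c \<ge> 0"
    using fin unfolding int c_def by auto
  \<comment> \<open>From \<open>(2 c + 1) P <= c\<close> follows \<open>P <= 1 / 2\<close>; the
    summand 1 covers \<open>c = 0\<close>.\<close>
  obtain m0 :: nat where m0: "\<And>t. t \<ge> real m0 \<Longrightarrow> H t \<ge> 2 * c + 1"
  proof -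
    have "eventually (\<lambda>t. H t \<ge> 2 * c + 1) at_top"
      using H(3) by (simp add: filterlim_at_top)
    then obtain t0 where t0: "\<And>t. t \<ge> t0 \<Longrightarrow> H t \<ge> 2 * c + 1" by (auto simp: eventually_at_top_linorder)
    obtain m0 :: nat where "t0 \<le> real m0" using real_arch_simple by blast
    then show ?thesis using t0 by (intro that[of m0]) auto
  qed
  have T: "T m \<le> 2 * emeasure M (E m)" if "m \<ge> m0" for m
  proof -
    have "ennreal (H (real m) * prob (E m)) \<le> ennreal c"
      using Hm[of m] H(1) c by (simp add: emeasure_eq_measure ennreal_mult less_imp_le)
    then have "H (real m) * prob (E m) \<le> c" using c(2) by simp
    moreover have "(2 * c + 1) * prob (E m) \<le> H (real m) * prob (E m)"
      using m0[of "real m"] that by (intro mult_right_mono) auto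
    ultimately have "2 * c * prob (E m) + prob (E m) \<le> c" by (simp add: distrib_right)
    have "prob (E m) \<le> 1 / 2"
    proof (rule ccontr)
      assume "\<not> prob (E m) \<le> 1 / 2"
      then have "prob (E m) > 1 / 2" by simp
      then have "c * (1 / 2) \<le> c * prob (E m)" using c by (intro mult_left_mono) auto
      with \<open>2 * c * prob (E m) + prob (E m) \<le> c\<close> \<open>prob (E m) > 1 / 2\<close> show False by simp
    qed
    then show ?thesis
      unfolding T_def q_def E_def by (intro suminf_tail_le_prob_Lsup[OF a])
  qed
  have Tfin: "T m < \<infinity>" for m
  proof -
    have "T m \<le> (\<Sum>n. ennreal (q n) * indicator {..m0} n + ennreal (q n) * indicator {m0<..} n)"
      unfolding T_def by (intro suminf_le) (auto simp: indicator_def)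
    also have "\<dots> = (\<Sum>n\<le>m0. ennreal (q n)) + T m0"
      unfolding T_def by (subst suminf_add[symmetric]) (auto simp: suminf_indicator_atMost)
    also have "\<dots> \<le> ennreal (\<Sum>n\<le>m0. q n) + 2 * emeasure M (E m0)"
      using T[of m0] by (intro add_mono) (auto simp: q_def)
    also have "\<dots> < \<infinity>" by (simp add: ennreal_mult_less_top emeasure_eq_measure)
    finally show ?thesis .
  qed
  have "(\<Sum>j. ennreal (H (real j)) * ennreal (q (Suc j))) =
    (\<Sum>j. (\<Sum>m. (ennreal (incr H m) * indicator {..j} m) * ennreal (q (Suc j))))"
    by (simp add: suminf_indicator_atMost nonneg sum_incr)
  also have "\<dots> = (\<Sum>m. \<Sum>j. (ennreal (incr H m) * indicator {..j} m) * ennreal (q (Suc j)))"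
    by (rule suminf_swap)
  \<comment> \<open>The condition \<open>m <= j\<close> is \<open>m < Suc j\<close>, so the inner
    sum is a tail past \<open>m\<close>.\<close>
  also have "\<dots> = (\<Sum>m. \<Sum>j. ennreal (incr H m) * (ennreal (q (Suc j)) * indicator {m<..} (Suc j)))"
    by (intro suminf_cong) (auto simp: indicator_def mult_ac)
  also have "\<dots> \<le> (\<Sum>m. ennreal (incr H m) * T m)"
  proof (intro suminf_le)
    fix m
    have "(\<Sum>j. ennreal (q (Suc j)) * indicator {m<..} (Suc j)) \<le> T m"
      unfolding T_def by (rule suminf_Suc_le)
    then show "(\<Sum>j. ennreal (incr H m) * (ennreal (q (Suc j)) * indicator {m<..} (Suc j))) \<le> ennreal (incr H m) * T m"
      by (simp add: mult_left_mono)
  qed auto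
  also have "\<dots> \<le> (\<Sum>m. ennreal (incr H m) * T m * indicator {..<m0} m + 2 * (ennreal (incr H m) * emeasure M (E m)))"
  proof (intro suminf_le)
    fix m
    show "ennreal (incr H m) * T m \<le> ennreal (incr H m) * T m * indicator {..<m0} m + 2 * (ennreal (incr H m) * emeasure M (E m))"
    proof (cases "m < m0")
      case False
      then have "ennreal (incr H m) * T m \<le> ennreal (incr H m) * (2 * emeasure M (E m))"
        by (intro mult_left_mono T) auto
      then show ?thesis using False by (simp add: mult_ac)
    qed simp
  qed auto
  also have "\<dots> = (\<Sum>m<m0. ennreal (incr H m) * T m) + 2 * (\<Sum>m. ennreal (incr H m) * emeasure M (E m))"
    by (subst suminf_add[symmetric]) (auto simp: suminf_indicator_lessThan)
  also have "\<dots> < \<infinity>"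
    using Tfin by (auto simp: c(1)[symmetric] ennreal_mult_less_top less_top[symmetric] ennreal_mult_eq_top_iff)
  finally show ?thesis by (simp add: q_def)
qed

text \<open>For \<open>t > 2\<close> at least \<open>t\<close> integers \<open>j >= 2 t\<close>
  satisfy \<open>(j + 1) / 4 <= t\<close>, the threshold belonging to \<open>a = 1 / 8\<close>, and
  \<open>H j >= H (2 t)\<close> for each of them. Spending the freedom in \<open>a\<close> this way
  gains the argument \<open>2 |X|\<close>, which the counterexample for non-moderate functions
  exploits.\<close>

lemma nn_integral_abs_times_finite:
  assumes H: "\<forall>t\<ge>0. H t > 0" "mono_on {0..} H" "filterlim H at_top at_top"
    and fin: "(\<integral>\<^sup>+\<omega>. Gext H (Lsup (\<lambda>n \<omega>. psum X n \<omega> / real n) 0 (1 / 8) \<omega>) \<partial>M) < \<infinity>"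
  shows "(\<integral>\<^sup>+\<omega>. ennreal (\<bar>X 0 \<omega>\<bar> * H (2 * \<bar>X 0 \<omega>\<bar>)) \<partial>M) < \<infinity>"
proof -
  have pos: "\<And>t. t \<ge> 0 \<Longrightarrow> H t > 0" using H by auto
  have ineq: "ennreal (t * H (2 * t)) \<le> ennreal (2 * H 4)
      + (\<Sum>j. ennreal (H (real j)) * indicator {j. 1 / 4 * real (Suc j) \<le> t} j)"
    if t: "t \<ge> 0" for t
  proof (cases "t \<le> 2")
    case True
    have "t * H (2 * t) \<le> 2 * H 4"
      using t True pos by (intro mult_mono mono_onD[OF H(2)]) (auto simp: less_imp_le)
    then have "ennreal (t * H (2 * t)) \<le> ennreal (2 * H 4)" by (rule ennreal_leI)
    then show ?thesis by (rule add_increasing2[rotated]) simp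
  next
    case False
    define J where "J = {nat \<lceil>2 * t\<rceil>..<nat \<lfloor>4 * t\<rfloor>}"
    have J: "2 * t \<le> real j" "1 / 4 * real (Suc j) \<le> t" if "j \<in> J" for j
    proof -
      show "2 * t \<le> real j" using that t by (auto simp: J_def nat_le_iff ceiling_le_iff)
      have "Suc j \<le> nat \<lfloor>4 * t\<rfloor>" using that by (auto simp: J_def)
      then have "real (Suc j) \<le> 4 * t" using t by (simp add: le_nat_floor le_nat_iff le_floor_iff)
      then show "1 / 4 * real (Suc j) \<le> t" by simp
    qed
    \<comment> \<open>The interval contains more than \<open>2 t - 2\<close> integers, and
      \<open>t > 2\<close>.\<close>
    have card: "t \<le> real (card J)"
      using False by (simp add: J_def) linarith
    have "t * H (2 * t) \<le> (\<Sum>j\<in>J. H (2 * t))"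
      using card pos[of "2 * t"] t by (simp add: mult_right_mono less_imp_le)
    also have "\<dots> \<le> (\<Sum>j\<in>J. H (real j))"
      using J t by (intro sum_mono mono_onD[OF H(2)]) auto
    finally have "ennreal (t * H (2 * t)) \<le> ennreal (\<Sum>j\<in>J. H (real j))" by (rule ennreal_leI)
    also have "\<dots> = (\<Sum>j\<in>J. ennreal (H (real j)) * indicator {j. 1 / 4 * real (Suc j) \<le> t} j)"
      using J pos by (subst sum_ennreal[symmetric]) (auto simp: less_imp_le intro!: sum.cong)
    also have "\<dots> \<le> (\<Sum>j. ennreal (H (real j)) * indicator {j. 1 / 4 * real (Suc j) \<le> t} j)"
      by (intro sum_le_suminf) (auto simp: J_def)
    finally show ?thesis by (rule order_trans) simp
  qed
  have [measurable]: "{\<omega> \<in> space M. 1 / 4 * real (Suc j) \<le> \<bar>X 0 \<omega>\<bar>} \<in> events" for j by measurable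
  have "(\<integral>\<^sup>+\<omega>. ennreal (\<bar>X 0 \<omega>\<bar> * H (2 * \<bar>X 0 \<omega>\<bar>)) \<partial>M) \<le> (\<integral>\<^sup>+\<omega>. ennreal (2 * H 4)
      + (\<Sum>j. ennreal (H (real j)) * indicator {\<omega> \<in> space M. 1 / 4 * real (Suc j) \<le> \<bar>X 0 \<omega>\<bar>} \<omega>) \<partial>M)"
    using ineq[of "\<bar>X 0 _\<bar>"] by (intro nn_integral_mono) (auto simp: indicator_def)
  also have "\<dots> = ennreal (2 * H 4)
      + (\<Sum>j. ennreal (H (real j)) * emeasure M {\<omega> \<in> space M. 1 / 4 * real (Suc j) \<le> \<bar>X 0 \<omega>\<bar>})"
    by (subst nn_integral_add)
       (auto simp: nn_integral_suminf nn_integral_cmult_indicator emeasure_space_1 intro!: suminf_cong)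
  also have "\<dots> < \<infinity>"
    using suminf_tails_finite[OF H _ fin] by (simp add: emeasure_eq_measure)
  finally show ?thesis .
qed

end

section \<open>An exponential inequality for truncated sums\<close>

text \<open>Second-order Taylor expansion with Lagrange remainder, where the factor
  \<open>1 / 2\<close> is given away.\<close>

lemma exp_le_quadratic:
  fixes w :: real
  assumes "\<bar>w\<bar> \<le> W"
  shows "exp w \<le> 1 + w + w\<^sup>2 * exp W"
proof -
  obtain t where t: "\<bar>t\<bar> \<le> \<bar>w\<bar>" "exp w = (\<Sum>m<2. w ^ m / fact m) + exp t / fact 2 * w ^ 2"
    using Maclaurin_exp_le[of w 2] by blast
  have "exp t / fact 2 \<le> exp W"
  proof -
    have "exp t \<le> exp W" using t assms by simp
    then have "exp t / 2 \<le> exp W" using exp_gt_zero[of W] by linarith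
    then show ?thesis by simp
  qed
  then have "exp t / fact 2 * w ^ 2 \<le> exp W * w ^ 2" by (intro mult_right_mono) auto
  with t(2) show ?thesis by (simp add: numeral_2_eq_2 mult.commute)
qed

text \<open>Large values are set to 0 rather than clipped, so that moments of the truncation are
  moments of \<open>X\<close> restricted to \<open>|X| <= y\<close>, the quantities summed over
  levels later.\<close>

definition trunc :: "real \<Rightarrow> real \<Rightarrow> real" where
  "trunc y z = (if \<bar>z\<bar> \<le> y then z else 0)"

lemma measurable_trunc [measurable]: "trunc y \<in> borel_measurable borel"
  unfolding trunc_def by measurable

lemma trunc_minus: "trunc y (- z) = - trunc y z"
  by (simp add: trunc_def)

lemma abs_trunc_le: "\<bar>trunc y z\<bar> \<le> \<bar>z\<bar>" "y \<ge> 0 \<Longrightarrow> \<bar>trunc y z\<bar> \<le> y"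
  by (auto simp: trunc_def)

context iid_rv
begin

definition tmean :: "real \<Rightarrow> real" where
  "tmean y = expectation (\<lambda>\<omega>. trunc y (X 0 \<omega>))"

definition tsquare :: "real \<Rightarrow> real" where
  "tsquare y = expectation (\<lambda>\<omega>. (trunc y (X 0 \<omega>))\<^sup>2)"

lemma tsquare_nonneg: "tsquare y \<ge> 0"
  unfolding tsquare_def by simp

lemma integrable_trunc_power:
  assumes "y \<ge> 0"
  shows "integrable M (\<lambda>\<omega>. trunc y (X 0 \<omega>) ^ k)"
  using assms abs_trunc_le(2)[of y]
  by (intro integrable_const_bound[where B = "y ^ k"]) (auto simp: power_abs power_mono intro!: AE_I2)

text \<open>The quadratic bound with \<open>W = l y\<close> integrates to \<open>1 + u\<close>, and
  \<open>1 + u <= exp u\<close> gives a form that multiplies well over independent factors.\<close>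

lemma expectation_exp_trunc_le:
  assumes "y \<ge> 0" "l > 0"
  shows "expectation (\<lambda>\<omega>. exp (l * trunc y (X i \<omega>))) \<le> exp (l * tmean y + l\<^sup>2 * exp (l * y) * tsquare y)"
proof -
  have "expectation (\<lambda>\<omega>. exp (l * trunc y (X i \<omega>))) = expectation (\<lambda>\<omega>. exp (l * trunc y (X 0 \<omega>)))"
    using integral_distr[of "X i" M borel "\<lambda>x. exp (l * trunc y x)"]
      integral_distr[of "X 0" M borel "\<lambda>x. exp (l * trunc y x)"] distr_X[of i] by simp
  also have "\<dots> \<le> expectation (\<lambda>\<omega>. 1 + l * trunc y (X 0 \<omega>) + l\<^sup>2 * exp (l * y) * (trunc y (X 0 \<omega>))\<^sup>2)"
  proof (rule integral_mono)
    have "\<bar>l * trunc y z\<bar> \<le> l * y" for z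
      using abs_trunc_le(2)[of y z] assms by (simp add: abs_mult)
    then show "exp (l * trunc y (X 0 \<omega>)) \<le> 1 + l * trunc y (X 0 \<omega>) + l\<^sup>2 * exp (l * y) * (trunc y (X 0 \<omega>))\<^sup>2" for \<omega>
      using exp_le_quadratic[of "l * trunc y (X 0 \<omega>)" "l * y"] by (simp add: power_mult_distrib mult_ac)
    have "trunc y z \<le> y" for z using abs_trunc_le(2)[of y z] assms by linarith
    then show "integrable M (\<lambda>\<omega>. exp (l * trunc y (X 0 \<omega>)))"
      using assms by (intro integrable_const_bound[where B = "exp (l * y)"]) (auto intro!: AE_I2)
    show "integrable M (\<lambda>\<omega>. 1 + l * trunc y (X 0 \<omega>) + l\<^sup>2 * exp (l * y) * (trunc y (X 0 \<omega>))\<^sup>2)"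
      using integrable_trunc_power[of y 1] integrable_trunc_power[of y 2] assms by simp
  qed
  also have "\<dots> = 1 + (l * tmean y + l\<^sup>2 * exp (l * y) * tsquare y)"
    using integrable_trunc_power[of y 1] integrable_trunc_power[of y 2] assms
    by (simp add: tmean_def tsquare_def prob_space)
  also have "\<dots> \<le> exp (l * tmean y + l\<^sup>2 * exp (l * y) * tsquare y)"
    by (rule exp_ge_add_one_self)
  finally show ?thesis .
qed

text \<open>Either some summand exceeds \<open>y\<close> in absolute value, which the union bound
  controls, or the sum equals the truncated sum, to which Chernoff's bound applies. Level
  \<open>y\<close> and rate \<open>l\<close> stay free for later choices.\<close>

lemma prob_sum_ge_le:
  assumes "finite I" "y \<ge> 0" "l > 0"
  shows "prob {\<omega> \<in> space M. x \<le> (\<Sum>i\<in>I. X i \<omega>)} \<le> card I * prob {\<omega> \<in> space M. y < \<bar>X 0 \<omega>\<bar>}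
     + exp (- l * x + card I * (l * tmean y + l\<^sup>2 * exp (l * y) * tsquare y))"
proof -
  define T where "T i \<omega> = trunc y (X i \<omega>)" for i \<omega>
  have [measurable]: "T i \<in> borel_measurable M" for i unfolding T_def by measurable
  have T: "T i \<omega> \<le> y" for i \<omega> using abs_trunc_le(2)[of y "X i \<omega>"] assms unfolding T_def by linarith
  have prod: "expectation (\<lambda>\<omega>. \<Prod>i\<in>I. exp (l * T i \<omega>)) = (\<Prod>i\<in>I. expectation (\<lambda>\<omega>. exp (l * T i \<omega>)))"
    unfolding T_def
  proof (rule indep_vars_lebesgue_integral[OF assms(1)])
    show "indep_vars (\<lambda>_. borel) (\<lambda>i \<omega>. exp (l * trunc y (X i \<omega>))) I"
      by (rule indep_vars_compose2[OF indep_vars_subset[OF indep_X]]) auto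
    show "integrable M (\<lambda>\<omega>. exp (l * trunc y (X i \<omega>)))" for i
      using T[of i, unfolded T_def] assms by (intro integrable_const_bound[where B = "exp (l * y)"]) (auto intro!: AE_I2)
  qed
  have "{\<omega> \<in> space M. x \<le> (\<Sum>i\<in>I. X i \<omega>)} \<subseteq> (\<Union>i\<in>I. {\<omega> \<in> space M. y < \<bar>X i \<omega>\<bar>}) \<union> {\<omega> \<in> space M. x \<le> (\<Sum>i\<in>I. T i \<omega>)}"
  proof
    fix \<omega> assume \<omega>: "\<omega> \<in> {\<omega> \<in> space M. x \<le> (\<Sum>i\<in>I. X i \<omega>)}"
    show "\<omega> \<in> (\<Union>i\<in>I. {\<omega> \<in> space M. y < \<bar>X i \<omega>\<bar>}) \<union> {\<omega> \<in> space M. x \<le> (\<Sum>i\<in>I. T i \<omega>)}"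
    proof (cases "\<exists>i\<in>I. y < \<bar>X i \<omega>\<bar>")
      case False
      then have "(\<Sum>i\<in>I. T i \<omega>) = (\<Sum>i\<in>I. X i \<omega>)"
        by (intro sum.cong) (auto simp: T_def trunc_def not_less)
      then show ?thesis using \<omega> by simp
    qed (use \<omega> in auto)
  qed
  then have "prob {\<omega> \<in> space M. x \<le> (\<Sum>i\<in>I. X i \<omega>)} \<le>
      prob ((\<Union>i\<in>I. {\<omega> \<in> space M. y < \<bar>X i \<omega>\<bar>}) \<union> {\<omega> \<in> space M. x \<le> (\<Sum>i\<in>I. T i \<omega>)})"
    using assms(1) by (intro finite_measure_mono) auto
  also have "\<dots> \<le> prob (\<Union>i\<in>I. {\<omega> \<in> space M. y < \<bar>X i \<omega>\<bar>}) + prob {\<omega> \<in> space M. x \<le> (\<Sum>i\<in>I. T i \<omega>)}"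
    using assms(1) by (intro measure_Un_le) auto
  also have "prob (\<Union>i\<in>I. {\<omega> \<in> space M. y < \<bar>X i \<omega>\<bar>}) \<le> (\<Sum>i\<in>I. prob {\<omega> \<in> space M. y < \<bar>X i \<omega>\<bar>})"
    using assms(1) by (intro finite_measure_subadditive_finite) auto
  also have "(\<Sum>i\<in>I. prob {\<omega> \<in> space M. y < \<bar>X i \<omega>\<bar>}) = (\<Sum>i\<in>I. prob {\<omega> \<in> space M. y < \<bar>X 0 \<omega>\<bar>})"
    by (intro sum.cong refl prob_X) measurable
  also have "\<dots> = card I * prob {\<omega> \<in> space M. y < \<bar>X 0 \<omega>\<bar>}" by simp
  also have "prob {\<omega> \<in> space M. x \<le> (\<Sum>i\<in>I. T i \<omega>)} \<le>
      exp (- l * x + card I * (l * tmean y + l\<^sup>2 * exp (l * y) * tsquare y))"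
  proof -
    have "prob {\<omega> \<in> space M. x \<le> (\<Sum>i\<in>I. T i \<omega>)} \<le>
        exp (- l * x) * (\<integral>\<omega>\<in>space M. exp (l * (\<Sum>i\<in>I. T i \<omega>)) \<partial>M)"
    proof (rule Chernoff_ineq_ge[OF assms(3)])
      have "(\<Sum>i\<in>I. T i \<omega>) \<le> card I * y" for \<omega>
        using sum_bounded_above[of I "\<lambda>i. T i \<omega>" y] T by simp
      then have "integrable M (\<lambda>\<omega>. exp (l * (\<Sum>i\<in>I. T i \<omega>)))"
        using assms by (intro integrable_const_bound[where B = "exp (l * (card I * y))"]) (auto intro!: AE_I2)
      then show "set_integrable M (space M) (\<lambda>\<omega>. exp (l * (\<Sum>i\<in>I. T i \<omega>)))"
        by (simp add: set_integrable_def cong: Bochner_Integration.integrable_cong)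
    qed simp
    also have "(\<integral>\<omega>\<in>space M. exp (l * (\<Sum>i\<in>I. T i \<omega>)) \<partial>M) = expectation (\<lambda>\<omega>. \<Prod>i\<in>I. exp (l * T i \<omega>))"
      unfolding set_lebesgue_integral_def
      by (intro Bochner_Integration.integral_cong) (auto simp: sum_distrib_left exp_sum assms)
    also have "\<dots> \<le> (\<Prod>i\<in>I. exp (l * tmean y + l\<^sup>2 * exp (l * y) * tsquare y))"
      unfolding prod using assms expectation_exp_trunc_le[of y l] by (intro prod_mono) (auto simp: T_def)
    also have "\<dots> = exp (card I * (l * tmean y + l\<^sup>2 * exp (l * y) * tsquare y))"
      by (simp add: exp_of_nat_mult)
    finally show ?thesis by (simp add: exp_add[symmetric] exp_add)
  qed
  finally show ?thesis by simp
qed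

text \<open>The one-sided bound for \<open>X\<close> and for \<open>- X\<close>: reflection changes
  the sign of the truncated mean and keeps the truncated second moment, so the absolute value of the
  mean serves both.\<close>

lemma prob_abs_sum_ge_le:
  assumes "finite I" "y \<ge> 0" "l > 0"
  shows "prob {\<omega> \<in> space M. x \<le> \<bar>\<Sum>i\<in>I. X i \<omega>\<bar>} \<le> 2 * (card I * prob {\<omega> \<in> space M. y < \<bar>X 0 \<omega>\<bar>}
     + exp (- l * x + card I * (l * \<bar>tmean y\<bar> + l\<^sup>2 * exp (l * y) * tsquare y)))"
    (is "_ \<le> 2 * (?A + ?B)")
proof -
  interpret neg: iid_rv M "\<lambda>n \<omega>. - X n \<omega>" by (rule iid_rv_compose) simp
  have neg: "neg.tmean y = - tmean y" "neg.tsquare y = tsquare y"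
    by (simp_all add: neg.tmean_def tmean_def neg.tsquare_def tsquare_def trunc_minus)
  have abs: "l * tmean y \<le> l * \<bar>tmean y\<bar>" "l * (- tmean y) \<le> l * \<bar>tmean y\<bar>"
    using mult_left_mono[OF abs_ge_self, of l "tmean y"] mult_left_mono[OF abs_ge_minus_self, of l "tmean y"] assms
    by simp_all
  have "prob {\<omega> \<in> space M. x \<le> (\<Sum>i\<in>I. X i \<omega>)} \<le> ?A + ?B"
    using assms by (intro order_trans[OF prob_sum_ge_le[OF assms]] add_left_mono)
      (auto intro!: mult_left_mono abs)
  moreover have "prob {\<omega> \<in> space M. x \<le> (\<Sum>i\<in>I. - X i \<omega>)} \<le> ?A + ?B"
    using assms by (intro order_trans[OF neg.prob_sum_ge_le[OF assms, unfolded abs_minus_cancel]] add_left_mono)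
      (use abs in \<open>auto simp: neg intro!: mult_left_mono\<close>)
  moreover have "prob {\<omega> \<in> space M. x \<le> \<bar>\<Sum>i\<in>I. X i \<omega>\<bar>} \<le>
      prob ({\<omega> \<in> space M. x \<le> (\<Sum>i\<in>I. X i \<omega>)} \<union> {\<omega> \<in> space M. x \<le> (\<Sum>i\<in>I. - X i \<omega>)})"
    by (intro finite_measure_mono) (auto simp: sum_negf)
  moreover have "\<dots> \<le> prob {\<omega> \<in> space M. x \<le> (\<Sum>i\<in>I. X i \<omega>)} + prob {\<omega> \<in> space M. x \<le> (\<Sum>i\<in>I. - X i \<omega>)}"
    by (intro measure_Un_le) auto
  ultimately have "prob {\<omega> \<in> space M. x \<le> \<bar>\<Sum>i\<in>I. X i \<omega>\<bar>} \<le> (?A + ?B) + (?A + ?B)"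
    by (meson add_mono order_trans)
  then show ?thesis by (simp only: mult_2)
qed

section \<open>A uniform weak law of large numbers\<close>

lemma tmean_tendsto:
  assumes "integrable M (X 0)"
  shows "(tmean \<longlongrightarrow> expectation (X 0)) at_top"
  unfolding tmean_def
proof (rule integral_dominated_convergence_at_top[where w = "\<lambda>\<omega>. \<bar>X 0 \<omega>\<bar>"])
  show "AE \<omega> in M. ((\<lambda>y. trunc y (X 0 \<omega>)) \<longlongrightarrow> X 0 \<omega>) at_top"
  proof (intro AE_I2 tendsto_eventually)
    fix \<omega> show "eventually (\<lambda>y. trunc y (X 0 \<omega>) = X 0 \<omega>) at_top"
      using eventually_ge_at_top[of "\<bar>X 0 \<omega>\<bar>"] by eventually_elim (simp add: trunc_def)
  qed
qed (use assms abs_trunc_le(1) in auto)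

text \<open>Dominated convergence: one factor of the squared truncation is at most \<open>y\<close>
  and the other at most \<open>|X|\<close>, so \<open>|X|\<close> dominates the quotient, while at
  each outcome the numerator is eventually constant.\<close>

lemma tsquare_div_tendsto:
  assumes "integrable M (X 0)"
  shows "((\<lambda>y. tsquare y / y) \<longlongrightarrow> 0) at_top"
proof -
  have "((\<lambda>y. expectation (\<lambda>\<omega>. (trunc y (X 0 \<omega>))\<^sup>2 / y)) \<longlongrightarrow> expectation (\<lambda>\<omega>. 0)) at_top"
  proof (rule integral_dominated_convergence_at_top[where w = "\<lambda>\<omega>. \<bar>X 0 \<omega>\<bar>"])
    show "AE \<omega> in M. ((\<lambda>y. (trunc y (X 0 \<omega>))\<^sup>2 / y) \<longlongrightarrow> 0) at_top"
    proof (intro AE_I2)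
      fix \<omega>
      have "((\<lambda>y. (X 0 \<omega>)\<^sup>2 / y) \<longlongrightarrow> 0) at_top" by real_asymp
      then show "((\<lambda>y. (trunc y (X 0 \<omega>))\<^sup>2 / y) \<longlongrightarrow> 0) at_top"
      proof (rule Lim_transform_eventually)
        show "eventually (\<lambda>y. (X 0 \<omega>)\<^sup>2 / y = (trunc y (X 0 \<omega>))\<^sup>2 / y) at_top"
          using eventually_ge_at_top[of "\<bar>X 0 \<omega>\<bar>"] by eventually_elim (simp add: trunc_def)
      qed
    qed
    show "eventually (\<lambda>y. AE \<omega> in M. norm ((trunc y (X 0 \<omega>))\<^sup>2 / y) \<le> \<bar>X 0 \<omega>\<bar>) at_top"
      using eventually_gt_at_top[of 0]
    proof eventually_elim
      case (elim y)
      show ?case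
      proof (intro AE_I2)
        fix \<omega>
        have "\<bar>trunc y (X 0 \<omega>)\<bar> * \<bar>trunc y (X 0 \<omega>)\<bar> \<le> \<bar>X 0 \<omega>\<bar> * y"
          using abs_trunc_le[of y "X 0 \<omega>"] elim by (intro mult_mono) auto
        then show "norm ((trunc y (X 0 \<omega>))\<^sup>2 / y) \<le> \<bar>X 0 \<omega>\<bar>"
          using elim by (simp add: power2_eq_square divide_simps abs_mult)
      qed
    qed
  qed (use assms in auto)
  then show ?thesis by (simp add: tsquare_def)
qed

lemma times_prob_abs_gt_tendsto:
  assumes "integrable M (X 0)"
  shows "((\<lambda>y. y * prob {\<omega> \<in> space M. y < \<bar>X 0 \<omega>\<bar>}) \<longlongrightarrow> 0) at_top"
proof -
  have "((\<lambda>y. expectation (\<lambda>\<omega>. y * indicator {\<omega> \<in> space M. y < \<bar>X 0 \<omega>\<bar>} \<omega>)) \<longlongrightarrow> expectation (\<lambda>\<omega>. 0)) at_top"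
  proof (rule integral_dominated_convergence_at_top[where w = "\<lambda>\<omega>. \<bar>X 0 \<omega>\<bar>"])
    show "AE \<omega> in M. ((\<lambda>y. y * indicator {\<omega> \<in> space M. y < \<bar>X 0 \<omega>\<bar>} \<omega>) \<longlongrightarrow> (0::real)) at_top"
    proof (intro AE_I2 tendsto_eventually)
      fix \<omega> show "eventually (\<lambda>y. y * indicator {\<omega> \<in> space M. y < \<bar>X 0 \<omega>\<bar>} \<omega> = (0::real)) at_top"
        using eventually_ge_at_top[of "\<bar>X 0 \<omega>\<bar>"] by eventually_elim simp
    qed
    show "eventually (\<lambda>y. AE \<omega> in M. norm (y * indicator {\<omega> \<in> space M. y < \<bar>X 0 \<omega>\<bar>} \<omega>) \<le> \<bar>X 0 \<omega>\<bar>) at_top"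
      using eventually_gt_at_top[of 0] by eventually_elim (auto simp: indicator_def)
  qed (use assms in auto)
  then show ?thesis by simp
qed

text \<open>The estimate sees the index set only through its cardinality. The factor 3 fits the
  later use: from \<open>j >= 2 ^ k\<close> to \<open>n <= 4 * 2 ^ k\<close> there are at most
  \<open>3 * 2 ^ k\<close> summands.\<close>

lemma uniform_weak_law:
  assumes int: "integrable M (X 0)" "expectation (X 0) = 0" and a: "a > 0"
  shows "eventually (\<lambda>y::real. \<forall>I. finite I \<longrightarrow> card I \<le> 3 * y \<longrightarrow>
    prob {\<omega> \<in> space M. a * y \<le> \<bar>\<Sum>i\<in>I. X i \<omega>\<bar>} \<le> 1 / 2) at_top"
proof -
  \<comment> \<open>At the rate \<open>K / y\<close> the exponent is at most
    \<open>- 5 + 1 + 1 = - 3\<close>. Then \<open>exp (- 3) <= 1 / 8\<close> and the large-jump term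
    \<open>3 / 24 = 1 / 8\<close> add up, after doubling, to \<open>1 / 2\<close>.\<close>
  define K where "K = 5 / a"
  have K: "K > 0" "K * a = 5" using a by (auto simp: K_def)
  have "eventually (\<lambda>y. \<bar>tmean y\<bar> < 1 / (3 * K)) at_top"
    using tmean_tendsto[OF int(1)] K int(2) by (auto simp: tendsto_iff dist_real_def)
  moreover have "eventually (\<lambda>y. \<bar>tsquare y / y\<bar> < 1 / (3 * K\<^sup>2 * exp K)) at_top"
    using tsquare_div_tendsto[OF int(1)] K by (auto simp: tendsto_iff dist_real_def)
  moreover have "eventually (\<lambda>y. \<bar>y * prob {\<omega> \<in> space M. y < \<bar>X 0 \<omega>\<bar>}\<bar> < 1 / 24) at_top"
    using times_prob_abs_gt_tendsto[OF int(1)] unfolding tendsto_iff dist_real_def diff_0_right by (elim allE[of _ "1 / 24"]) simp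
  ultimately show ?thesis using eventually_gt_at_top[of 0]
  proof eventually_elim
    case (elim y)
    show ?case
    proof (intro allI impI)
      fix I :: "nat set" assume I: "finite I" "card I \<le> 3 * y"
      define q where "q = prob {\<omega> \<in> space M. y < \<bar>X 0 \<omega>\<bar>}"
      have "3 * K * \<bar>tmean y\<bar> \<le> 1" using elim(1) K by (simp add: field_simps)
      have "3 * K\<^sup>2 * exp K * (tsquare y / y) \<le> 1"
        using elim(2,4) K tsquare_nonneg[of y] by (simp add: field_simps)
      have l: "K / y > 0" using K elim by simp
      have "prob {\<omega> \<in> space M. a * y \<le> \<bar>\<Sum>i\<in>I. X i \<omega>\<bar>} \<le> 2 * (card I * q
        + exp (- (K / y) * (a * y) + card I * ((K / y) * \<bar>tmean y\<bar> + (K / y)\<^sup>2 * exp ((K / y) * y) * tsquare y)))"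
        unfolding q_def using elim by (intro prob_abs_sum_ge_le I l) simp
      also have "\<dots> \<le> 2 * (3 * y * q
        + exp (- (K / y) * (a * y) + 3 * y * ((K / y) * \<bar>tmean y\<bar> + (K / y)\<^sup>2 * exp ((K / y) * y) * tsquare y)))"
      proof -
        define u where "u = (K / y) * \<bar>tmean y\<bar> + (K / y)\<^sup>2 * exp ((K / y) * y) * tsquare y"
        have "u \<ge> 0" using K elim(4) tsquare_nonneg[of y] by (auto simp: u_def)
        then have "card I * u \<le> 3 * y * u" using I by (intro mult_right_mono) auto
        moreover have "card I * q \<le> 3 * y * q" using I by (intro mult_right_mono) (auto simp: q_def)
        ultimately show ?thesis unfolding u_def[symmetric] by (intro mult_left_mono add_mono) auto
      qed
      also have "- (K / y) * (a * y) + 3 * y * ((K / y) * \<bar>tmean y\<bar> + (K / y)\<^sup>2 * exp ((K / y) * y) * tsquare y)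
        = - 5 + 3 * K * \<bar>tmean y\<bar> + 3 * K\<^sup>2 * exp K * (tsquare y / y)"
        using elim(4) K by (simp add: field_simps power2_eq_square)
      also have "exp \<dots> \<le> exp (- 3)"
        using \<open>3 * K * \<bar>tmean y\<bar> \<le> 1\<close> \<open>3 * K\<^sup>2 * exp K * (tsquare y / y) \<le> 1\<close> by simp
      also have "exp (- 3 :: real) \<le> 1 / 8"
        using exp_ge_one_plus_x_over_n_power_n[of 3 3] by (simp add: exp_minus divide_simps)
      also have "3 * y * q \<le> 1 / 8" using elim(3) elim(4) by (simp add: q_def)
      finally show "prob {\<omega> \<in> space M. a * y \<le> \<bar>\<Sum>i\<in>I. X i \<omega>\<bar>} \<le> 1 / 2" by simp
    qed
  qed
qed

end

section \<open>Convexity and series estimates for the tail bounds\<close>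

lemma suminf_ennreal_finite_if_eventually_le:
  fixes f g :: "nat \<Rightarrow> ennreal"
  assumes "\<And>k. k \<ge> k0 \<Longrightarrow> f k \<le> g k" "\<And>k. f k < \<infinity>" "(\<Sum>k. g k) < \<infinity>"
  shows "(\<Sum>k. f k) < \<infinity>"
proof -
  have "(\<Sum>k. f k) \<le> (\<Sum>k. f k * indicator {..<k0} k + g k)"
    using assms(1) by (intro suminf_le) (auto simp: indicator_def not_less)
  also have "\<dots> = (\<Sum>k<k0. f k) + (\<Sum>k. g k)"
    by (subst suminf_add[symmetric]) (auto simp: suminf_indicator_lessThan)
  also have "\<dots> < \<infinity>" using assms(2,3) by (auto simp: less_top[symmetric])
  finally show ?thesis .
qed

text \<open>Convexity of the power function: Bernoulli's inequality at \<open>z / u - 1\<close>,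
  scaled by \<open>u ^ r\<close>.\<close>

lemma power_tangent_le:
  fixes z u :: real
  assumes "z \<ge> 0" "u > 0"
  shows "u ^ r + real r * u ^ (r - 1) * (z - u) \<le> z ^ r"
proof (cases r)
  case (Suc k)
  have "1 + real r * (z / u - 1) \<le> (1 + (z / u - 1)) ^ r"
    using assms by (intro Bernoulli_inequality) simp
  then have "u ^ r * (1 + real r * (z / u - 1)) \<le> u ^ r * (z / u) ^ r"
    using assms by (intro mult_left_mono) auto
  also have "\<dots> = z ^ r" using assms by (simp add: power_divide)
  also have "u ^ r * (1 + real r * (z / u - 1)) = u ^ r + real r * u ^ (r - 1) * (z - u)"
    using assms Suc by (simp add: field_simps)
  finally show ?thesis .
qed simp

text \<open>Squares \<open>w / 4 <= exp (w / 4)\<close>; this absorbs the square of a logarithmic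
  rate in the Chernoff bound.\<close>

lemma square_times_exp_le:
  fixes w :: real
  assumes "w \<ge> 0"
  shows "w\<^sup>2 * exp (- w / 2) \<le> 16"
proof -
  have "w / 4 \<le> exp (w / 4)" using exp_ge_add_one_self[of "w / 4"] by linarith
  then have "(w / 4)\<^sup>2 \<le> (exp (w / 4))\<^sup>2" using assms by (intro power_mono) auto
  also have "\<dots> = exp (w / 2)" by (simp add: power2_eq_square exp_add[symmetric])
  finally have "w\<^sup>2 / 16 \<le> exp (w / 2)" by (simp add: power_divide)
  then show ?thesis by (simp add: exp_minus divide_simps)
qed

text \<open>At most \<open>t / b\<close> indices contribute, and each term is at most
  \<open>G (t / b)\<close>, hence at most \<open>C * (1 / b) ^ p * G t\<close>.\<close>

lemma suminf_moderate_below_le: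
  assumes G: "\<forall>t\<ge>0. G t > 0" "mono_on {0..} G" and b: "0 < b" "b \<le> 1" and C: "C \<ge> 1"
    and growth: "\<And>s t. 0 < t \<Longrightarrow> t \<le> s \<Longrightarrow> G s \<le> C * (s / t) ^ p * G t"
    and t: "t \<ge> 0"
  shows "(\<Sum>k. ennreal (G (real (Suc k))) * indicator {k. b * real (Suc k) < t} k)
    \<le> ennreal (C * (1 / b) ^ (p + 1) * (t * G t))"
proof (cases "t = 0")
  case True
  have "b * real (Suc k) \<ge> 0" for k using b by simp
  then have "\<not> b * real (Suc k) < 0" for k by (simp add: not_less)
  then show ?thesis using True by simp
next
  case False
  with t have t: "t > 0" by simp
  have pos: "G t > 0" using G(1) t by auto
  define N where "N = nat \<lfloor>t / b\<rfloor>"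
  have N: "k < N" if "b * real (Suc k) < t" for k
  proof -
    have "real (Suc k) \<le> t / b" using that b by (simp add: field_simps)
    then have "Suc k \<le> N" unfolding N_def by (intro le_nat_floor) simp
    then show ?thesis by simp
  qed
  have "real N \<le> t / b" using t b by (simp add: N_def)
  have bound: "ennreal (G (real (Suc k))) * indicator {k. b * real (Suc k) < t} k \<le> ennreal (C * (1 / b) ^ p * G t)" for k
  proof (cases "b * real (Suc k) < t")
    case True
    have "G (real (Suc k)) \<le> G (t / b)"
      using True b t by (intro mono_onD[OF G(2)]) (auto simp: field_simps)
    also have "\<dots> \<le> C * ((t / b) / t) ^ p * G t"
      using t b by (intro growth) (auto simp: field_simps)
    also have "(t / b) / t = 1 / b" using t by simp
    finally show ?thesis using True by (simp add: ennreal_leI)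
  qed simp
  have "(\<Sum>k. ennreal (G (real (Suc k))) * indicator {k. b * real (Suc k) < t} k) =
      (\<Sum>k<N. ennreal (G (real (Suc k))) * indicator {k. b * real (Suc k) < t} k)"
    using N by (intro suminf_finite) (auto simp: indicator_def)
  also have "\<dots> \<le> of_nat (card {..<N}) * ennreal (C * (1 / b) ^ p * G t)"
    using bound by (rule sum_bounded_above)
  also have "\<dots> = ennreal (real N * (C * (1 / b) ^ p * G t))"
    using C b pos by (simp add: ennreal_mult ennreal_of_nat_eq_real_of_nat)
  also have "\<dots> \<le> ennreal (t / b * (C * (1 / b) ^ p * G t))"
    using \<open>real N \<le> t / b\<close> C b pos by (intro ennreal_leI mult_right_mono) auto
  also have "t / b * (C * (1 / b) ^ p * G t) = C * (1 / b) ^ (p + 1) * (t * G t)" by simp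
  finally show ?thesis .
qed

text \<open>Growth of order \<open>p\<close> against the power \<open>p + 2\<close> leaves
  \<open>t ^ 2 / n ^ 2\<close>, and the sum of \<open>1 / n ^ 2\<close> from \<open>t\<close> on is
  at most \<open>2 / t\<close>.\<close>

lemma suminf_moderate_above_le:
  assumes G: "\<forall>t\<ge>0. G t > 0" and C: "C \<ge> 1"
    and growth: "\<And>s t. 0 < t \<Longrightarrow> t \<le> s \<Longrightarrow> G s \<le> C * (s / t) ^ p * G t"
    and t: "t \<ge> 0"
  shows "(\<Sum>k. ennreal (G (real (Suc k)) / real (Suc k) ^ (p + 2) * t ^ (p + 2)) * indicator {k. t \<le> real (Suc k)} k)
    \<le> ennreal (2 * C * (t * G t))"
proof (cases "t = 0")
  case False
  with t have t: "t > 0" by simp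
  have pos: "G t > 0" using G t by auto
  have "(\<Sum>k. ennreal (G (real (Suc k)) / real (Suc k) ^ (p + 2) * t ^ (p + 2)) * indicator {k. t \<le> real (Suc k)} k) \<le>
      (\<Sum>k. ennreal (C * t\<^sup>2 * G t) * (ennreal (1 / real (Suc k) ^ 2) * indicator {k. t \<le> real (Suc k)} k))"
  proof (intro suminf_le)
    fix k
    show "ennreal (G (real (Suc k)) / real (Suc k) ^ (p + 2) * t ^ (p + 2)) * indicator {k. t \<le> real (Suc k)} k \<le>
      ennreal (C * t\<^sup>2 * G t) * (ennreal (1 / real (Suc k) ^ 2) * indicator {k. t \<le> real (Suc k)} k)"
    proof (cases "t \<le> real (Suc k)")
      case True
      define n where "n = real (Suc k)"
      have n: "n > 0" by (simp add: n_def)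
      have "G n / n ^ (p + 2) * t ^ (p + 2) \<le> (C * (n / t) ^ p * G t) / n ^ (p + 2) * t ^ (p + 2)"
        using growth[of t n] True t n by (intro mult_right_mono divide_right_mono) (auto simp: n_def)
      also have "\<dots> = C * t\<^sup>2 * G t * (1 / n ^ 2)"
        using t n by (simp add: field_simps power_add power2_eq_square)
      finally have "ennreal (G n / n ^ (p + 2) * t ^ (p + 2)) \<le> ennreal (C * t\<^sup>2 * G t * (1 / n ^ 2))"
        by (rule ennreal_leI)
      also have "\<dots> = ennreal (C * t\<^sup>2 * G t) * ennreal (1 / n ^ 2)"
        using C pos by (intro ennreal_mult) auto
      finally show ?thesis using True by (simp add: n_def)
    qed simp
  qed auto
  also have "\<dots> \<le> ennreal (C * t\<^sup>2 * G t) * ennreal (2 / t)"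
    using suminf_inverse_square_ge_le[OF t] by (simp add: mult_left_mono)
  also have "\<dots> = ennreal (C * t\<^sup>2 * G t * (2 / t))"
    using C pos t by (intro ennreal_mult[symmetric]) auto
  also have "C * t\<^sup>2 * G t * (2 / t) = 2 * C * (t * G t)"
    using t by (simp add: field_simps power2_eq_square)
  finally show ?thesis .
qed simp

context iid_rv
begin

section \<open>Tail bounds for the means\<close>

text \<open>Chernoff's bound at truncation level \<open>b n\<close> with a rate proportional to
  \<open>- ln v / n\<close>, for \<open>v\<close> just above \<open>tsquare (b n) / n\<close>,
  becomes a multiple of \<open>v ^ r\<close>. Centering makes the truncated mean at most
  \<open>a / 2\<close> from \<open>n0\<close> on, so half of the threshold \<open>a n\<close>
  remains.\<close>

lemma prob_abs_sum_ge_le_power: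
  assumes int: "integrable M (X 0)" "expectation (X 0) = 0" and a: "a > 0" and r: "r \<ge> 1"
  obtains b D n0 where "0 < b" "b \<le> 1" "D \<ge> 0"
    "\<And>n. n \<ge> n0 \<Longrightarrow> n \<ge> 1 \<Longrightarrow> prob {\<omega> \<in> space M. a * real n \<le> \<bar>\<Sum>i\<in>{1..n}. X i \<omega>\<bar>} \<le>
      2 * (real n * prob {\<omega> \<in> space M. b * real n < \<bar>X 0 \<omega>\<bar>} + D * (tsquare (b * real n) / real n) ^ r)"
proof -
  define c where "c = 2 * real r / a"
  define b where "b = min 1 (a / (4 * real r))"
  define D where "D = exp (16 * c\<^sup>2)"
  have c: "c > 0" using a r by (simp add: c_def)
  have b: "0 < b" "b \<le> 1" using a r by (auto simp: b_def)
  have bc: "b * c \<le> 1 / 2"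
  proof -
    have "b * c \<le> a / (4 * real r) * c" using c by (intro mult_right_mono) (auto simp: b_def)
    also have "\<dots> = 1 / 2" using a r by (simp add: c_def)
    finally show ?thesis .
  qed
  have D: "D \<ge> 1" using c by (simp add: D_def)
  have "eventually (\<lambda>y. \<bar>tmean y\<bar> < a / 2) at_top"
    using order_tendstoD(2)[OF tendsto_rabs[OF tmean_tendsto[OF int(1)]], of "a / 2"] a int(2) by simp
  then obtain y0 where y0: "\<And>y. y \<ge> y0 \<Longrightarrow> \<bar>tmean y\<bar> < a / 2" by (auto simp: eventually_at_top_linorder)
  obtain n0 :: nat where n0: "y0 / b \<le> real n0" using real_arch_simple by blast
  show ?thesis
  proof (rule that[of b D n0])
    fix n :: nat assume n: "n \<ge> n0" "n \<ge> 1"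
    define y where "y = b * real n"
    define q where "q = prob {\<omega> \<in> space M. y < \<bar>X 0 \<omega>\<bar>}"
    define V where "V = tsquare y / real n"
    define P where "P = prob {\<omega> \<in> space M. a * real n \<le> \<bar>\<Sum>i\<in>{1..n}. X i \<omega>\<bar>}"
    have "y0 / b \<le> real n" using n0 n by linarith
    then have "y0 \<le> y" using b by (simp add: y_def field_simps)
    then have tm: "\<bar>tmean y\<bar> \<le> a / 2" using y0 by (simp add: less_imp_le)
    have V: "V \<ge> 0" using tsquare_nonneg[of y] by (simp add: V_def)
    have bound: "P \<le> 2 * (real n * q + D * v ^ r)" if v: "v > V" for v
    proof (cases "v < 1")
      case False
      \<comment> \<open>For \<open>v >= 1\<close> the right-hand side already exceeds every
        probability.\<close>
      then have "1 * 1 \<le> D * v ^ r" using D by (intro mult_mono one_le_power) auto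
      moreover have "P \<le> 1" by (simp add: P_def)
      moreover have "real n * q \<ge> 0" by (simp add: q_def)
      moreover have "P \<le> 2 * (e + d)" if "1 * 1 \<le> d" "P \<le> 1" "e \<ge> 0" for d e :: real
        using that by simp
      ultimately show ?thesis by blast
    next
      case True
      have v0: "v > 0" using v V by linarith
      define w where "w = - ln v"
      have w: "w > 0" "v = exp (- w)" using True v0 by (auto simp: w_def)
      \<comment> \<open>The rate \<open>L / n\<close> makes \<open>exp (- L a / 2) = v ^ r\<close>, while \<open>b c \<le> 1 / 2\<close> keeps the
        quadratic term below a multiple of \<open>w\<^sup>2 exp (- w / 2)\<close>.\<close>
      define L where "L = c * w"
      have L: "L > 0" using c w by (simp add: L_def)
      have "P \<le> 2 * (card {1..n} * q + exp (- (L / n) * (a * n) + card {1..n} * ((L / n) * \<bar>tmean y\<bar>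
          + (L / n)\<^sup>2 * exp ((L / n) * y) * tsquare y)))"
        unfolding P_def q_def using b L n by (intro prob_abs_sum_ge_le) (auto simp: y_def)
      also have "- (L / n) * (a * n) + card {1..n} * ((L / n) * \<bar>tmean y\<bar>
          + (L / n)\<^sup>2 * exp ((L / n) * y) * tsquare y) = - L * a + L * \<bar>tmean y\<bar> + L\<^sup>2 * exp (b * L) * V"
        using n by (simp add: V_def y_def field_simps power2_eq_square)
      also have "\<dots> \<le> - L * a + L * (a / 2) + 16 * c\<^sup>2"
      proof -
        have "L * \<bar>tmean y\<bar> \<le> L * (a / 2)" using tm L by (intro mult_left_mono) auto
        moreover have "L\<^sup>2 * exp (b * L) * V \<le> 16 * c\<^sup>2"
        proof -
          have "b * L \<le> w / 2" using mult_right_mono[OF bc, of w] w by (simp add: L_def mult.assoc)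
          then have "L\<^sup>2 * exp (b * L) * V \<le> L\<^sup>2 * exp (w / 2) * v"
            using v V by (intro mult_mono) auto
          also have "\<dots> = c\<^sup>2 * (w\<^sup>2 * exp (- w / 2))"
            unfolding w(2) L_def by (simp add: power_mult_distrib exp_add[symmetric])
          also have "\<dots> \<le> c\<^sup>2 * 16" using w square_times_exp_le[of w] by (intro mult_left_mono) auto
          finally show ?thesis by simp
        qed
        ultimately show ?thesis by linarith
      qed
      also have "- L * a + L * (a / 2) + 16 * c\<^sup>2 = real r * (- w) + 16 * c\<^sup>2"
        using a by (simp add: L_def c_def field_simps)
      also have "exp (real r * (- w) + 16 * c\<^sup>2) = D * v ^ r"
        unfolding exp_add D_def w(2) by (simp add: exp_of_nat_mult[symmetric])
      finally show ?thesis by simp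
    qed
    \<comment> \<open>\<open>V\<close> may vanish, so its logarithm is only taken for \<open>v > V\<close>.\<close>
    have "P \<le> 2 * (real n * q + D * V ^ r)"
    proof (rule tendsto_lowerbound)
      show "((\<lambda>v. 2 * (real n * q + D * v ^ r)) \<longlongrightarrow> 2 * (real n * q + D * V ^ r)) (at_right V)"
        by (intro tendsto_intros)
      show "eventually (\<lambda>v. P \<le> 2 * (real n * q + D * v ^ r)) (at_right V)"
        using eventually_at_right_less[of V] by eventually_elim (rule bound)
    qed simp
    then show "prob {\<omega> \<in> space M. a * real n \<le> \<bar>\<Sum>i\<in>{1..n}. X i \<omega>\<bar>} \<le>
      2 * (real n * prob {\<omega> \<in> space M. b * real n < \<bar>X 0 \<omega>\<bar>} + D * (tsquare (b * real n) / real n) ^ r)"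
      by (simp add: P_def q_def V_def y_def)
  qed (use b D in auto)
qed

text \<open>Jensen's inequality for \<open>x \<mapsto> x ^ r\<close> under the probability with density proportional to
  \<open>Z = \<bar>trunc y (X 0)\<bar>\<close>, proved through the tangent at \<open>u = E[Z\<^sup>2] / E[Z]\<close>.\<close>

lemma tsquare_power_le:
  assumes int: "integrable M (X 0)" and y: "y \<ge> 0" and r: "r \<ge> 1"
  shows "tsquare y ^ r \<le> expectation (\<lambda>\<omega>. \<bar>X 0 \<omega>\<bar>) ^ (r - 1) * expectation (\<lambda>\<omega>. \<bar>trunc y (X 0 \<omega>)\<bar> ^ (r + 1))"
proof (cases "tsquare y = 0")
  case True
  then show ?thesis using r by (simp add: power_0_left)
next
  case False
  then have s: "tsquare y > 0" using tsquare_nonneg[of y] by simp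
  define Z where "Z \<omega> = \<bar>trunc y (X 0 \<omega>)\<bar>" for \<omega>
  have Z: "Z \<omega> \<ge> 0" "Z \<omega> \<le> y" "Z \<omega> \<le> \<bar>X 0 \<omega>\<bar>" for \<omega>
    using abs_trunc_le[of y "X 0 \<omega>"] y by (auto simp: Z_def)
  have intZ: "integrable M (\<lambda>\<omega>. Z \<omega> ^ k)" for k
    using integrable_abs[OF integrable_trunc_power[OF y, of k]] by (simp add: Z_def power_abs)
  define m where "m = expectation Z"
  have tsq: "tsquare y = expectation (\<lambda>\<omega>. Z \<omega> ^ 2)" by (simp add: tsquare_def Z_def)
  have "expectation (\<lambda>\<omega>. Z \<omega> ^ 2) \<le> expectation (\<lambda>\<omega>. y * Z \<omega>)"
    using intZ[of 2] intZ[of 1] Z by (intro integral_mono) (auto simp: power2_eq_square mult_right_mono)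
  \<comment> \<open>A positive second moment forces a positive first moment, so \<open>u\<close> may
    be formed by dividing by \<open>m\<close>.\<close>
  then have "tsquare y \<le> y * m" using intZ[of 1] by (simp add: m_def tsq)
  with s have "m \<noteq> 0" by auto
  moreover have "m \<ge> 0" unfolding m_def using Z by simp
  ultimately have m: "m > 0" by simp
  define u where "u = tsquare y / m"
  have u: "u > 0" "u * m = tsquare y" using m s by (simp_all add: u_def)
  \<comment> \<open>The choice of \<open>u\<close> gives \<open>E[Z (Z - u)] = 0\<close>, so the
    tangent integrated against \<open>Z\<close> leaves exactly \<open>u ^ r * m\<close>.\<close>
  have "u ^ r * m = expectation (\<lambda>\<omega>. (u ^ r - real r * u ^ (r - 1) * u) * Z \<omega> + real r * u ^ (r - 1) * Z \<omega> ^ 2)"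
    using intZ[of 1] intZ[of 2] u by (simp add: m_def[symmetric] tsq[symmetric] algebra_simps)
  also have "\<dots> \<le> expectation (\<lambda>\<omega>. Z \<omega> ^ (r + 1))"
  proof (rule integral_mono)
    fix \<omega>
    have "Z \<omega> * (u ^ r + real r * u ^ (r - 1) * (Z \<omega> - u)) \<le> Z \<omega> * Z \<omega> ^ r"
      using Z u by (intro mult_left_mono power_tangent_le) auto
    then show "(u ^ r - real r * u ^ (r - 1) * u) * Z \<omega> + real r * u ^ (r - 1) * Z \<omega> ^ 2 \<le> Z \<omega> ^ (r + 1)"
      by (simp add: algebra_simps power2_eq_square)
  qed (use intZ[of 1] intZ[of 2] intZ[of "r + 1"] in auto)
  finally have le: "u ^ r * m \<le> expectation (\<lambda>\<omega>. Z \<omega> ^ (r + 1))" .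
  have "tsquare y ^ r = u ^ r * m ^ r" by (simp add: u(2)[symmetric] power_mult_distrib)
  also have "m ^ r = m ^ (r - 1) * m" using r by (cases r) auto
  also have "u ^ r * (m ^ (r - 1) * m) = m ^ (r - 1) * (u ^ r * m)" by simp
  also have "\<dots> \<le> m ^ (r - 1) * expectation (\<lambda>\<omega>. Z \<omega> ^ (r + 1))"
    using le m by (intro mult_left_mono) auto
  also have "\<dots> \<le> expectation (\<lambda>\<omega>. \<bar>X 0 \<omega>\<bar>) ^ (r - 1) * expectation (\<lambda>\<omega>. Z \<omega> ^ (r + 1))"
  proof (intro mult_right_mono power_mono)
    show "m \<le> expectation (\<lambda>\<omega>. \<bar>X 0 \<omega>\<bar>)"
      unfolding m_def using intZ[of 1] int Z by (intro integral_mono) auto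
  qed (use m Z in auto)
  finally show ?thesis by (simp add: Z_def)
qed

text \<open>The tail bound times \<open>G n / n\<close> is at most an expectation of a function of
  \<open>|X|\<close>. Exchanging sum and expectation reduces the claim to a fixed
  \<open>t = |X|\<close>, where the indices with \<open>b n < t\<close> and those with
  \<open>n >= t\<close> each contribute at most a multiple of \<open>t G(t)\<close>.\<close>

lemma suminf_prob_mean_ge_finite:
  assumes G: "moderate G" and int: "integrable M (X 0)" "expectation (X 0) = 0" and a: "a > 0"
    and fin: "(\<integral>\<^sup>+\<omega>. ennreal (\<bar>X 0 \<omega>\<bar> * G \<bar>X 0 \<omega>\<bar>) \<partial>M) < \<infinity>"
  shows "(\<Sum>k. ennreal (G (real (Suc k)) / real (Suc k) *
      prob {\<omega> \<in> space M. a \<le> \<bar>psum X (Suc k) \<omega> / real (Suc k)\<bar>})) < \<infinity>"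
proof -
  have G': "\<forall>t\<ge>0. G t > 0" "mono_on {0..} G" using G by (auto simp: moderate_def)
  obtain C p where C: "C \<ge> 1" "p \<ge> 1"
    and growth: "\<And>s t. 0 < t \<Longrightarrow> t \<le> s \<Longrightarrow> G s \<le> C * (s / t) ^ p * G t"
    using moderate_polynomial_growth[OF G] by metis
  \<comment> \<open>Together with the weight \<open>G n / n\<close> this puts
    \<open>n ^ (p + 2)\<close> into the denominator, two powers more than the growth of
    \<open>G\<close>.\<close>
  define r where "r = p + 1"
  obtain b D n0 where b: "0 < b" "b \<le> 1" and D: "D \<ge> 0" and
    tail: "\<And>n. n \<ge> n0 \<Longrightarrow> n \<ge> 1 \<Longrightarrow> prob {\<omega> \<in> space M. a * real n \<le> \<bar>\<Sum>i\<in>{1..n}. X i \<omega>\<bar>} \<le>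
      2 * (real n * prob {\<omega> \<in> space M. b * real n < \<bar>X 0 \<omega>\<bar>} + D * (tsquare (b * real n) / real n) ^ r)"
    using prob_abs_sum_ge_le_power[OF int a, of r] by (auto simp: r_def)
  define A where "A = D * expectation (\<lambda>\<omega>. \<bar>X 0 \<omega>\<bar>) ^ p"
  have A: "A \<ge> 0" using D by (simp add: A_def)
  \<comment> \<open>For \<open>n = Suc k\<close>, the first summand accounts for jumps beyond
    \<open>b n\<close>, the second for the truncated moment of order \<open>p + 2\<close>.\<close>
  define f where "f k t = 2 * (ennreal (G (real (Suc k))) * indicator {k. b * real (Suc k) < t} k) +
    ennreal (2 * A) * (ennreal (G (real (Suc k)) / real (Suc k) ^ (p + 2) * t ^ (p + 2)) * indicator {k. t \<le> real (Suc k)} k)"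
    for k t
  have [measurable]: "(\<lambda>\<omega>. f k \<bar>X 0 \<omega>\<bar>) \<in> borel_measurable M" for k
    unfolding f_def indicator_def mem_Collect_eq by measurable
  define Q where "Q = 2 * (C * (1 / b) ^ (p + 1)) + 2 * A * (2 * C)"
  have Q: "Q \<ge> 0" using A C b by (simp add: Q_def)
  have f_le: "(\<Sum>k. f k t) \<le> ennreal (Q * (t * G t))" if "t \<ge> 0" for t
  proof -
    have "(\<Sum>k. f k t) = 2 * (\<Sum>k. ennreal (G (real (Suc k))) * indicator {k. b * real (Suc k) < t} k) +
       ennreal (2 * A) * (\<Sum>k. ennreal (G (real (Suc k)) / real (Suc k) ^ (p + 2) * t ^ (p + 2)) * indicator {k. t \<le> real (Suc k)} k)"
      unfolding f_def by (subst suminf_add[symmetric]) (simp_all only: ennreal_suminf_cmult summableI)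
    also have "\<dots> \<le> ennreal 2 * ennreal (C * (1 / b) ^ (p + 1) * (t * G t)) + ennreal (2 * A) * ennreal (2 * C * (t * G t))"
      using suminf_moderate_below_le[OF G' b C(1) growth that] suminf_moderate_above_le[OF G'(1) C(1) growth that]
      unfolding ennreal_numeral by (intro add_mono mult_left_mono zero_le)
    also have "\<dots> = ennreal (2 * (C * (1 / b) ^ (p + 1) * (t * G t)) + 2 * A * (2 * C * (t * G t)))"
    proof -
      have "ennreal 2 * ennreal u + ennreal v * ennreal w = ennreal (2 * u + v * w)"
        if "u \<ge> 0" "v \<ge> 0" "w \<ge> 0" for u v w :: real
        using that by (simp add: ennreal_plus ennreal_mult)
      then show ?thesis using A C b G'(1) that by (simp add: less_imp_le)
    qed
    finally show ?thesis by (simp add: Q_def algebra_simps)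
  qed
  show ?thesis
  proof (rule suminf_ennreal_finite_if_eventually_le)
    have "(\<Sum>k. \<integral>\<^sup>+\<omega>. f k \<bar>X 0 \<omega>\<bar> \<partial>M) = (\<integral>\<^sup>+\<omega>. (\<Sum>k. f k \<bar>X 0 \<omega>\<bar>) \<partial>M)"
      by (rule nn_integral_suminf[symmetric]) measurable
    also have "\<dots> \<le> (\<integral>\<^sup>+\<omega>. ennreal Q * ennreal (\<bar>X 0 \<omega>\<bar> * G \<bar>X 0 \<omega>\<bar>) \<partial>M)"
      using f_le Q G'(1) by (intro nn_integral_mono) (simp add: ennreal_mult[symmetric] less_imp_le)
    also have "\<dots> = ennreal Q * (\<integral>\<^sup>+\<omega>. ennreal (\<bar>X 0 \<omega>\<bar> * G \<bar>X 0 \<omega>\<bar>) \<partial>M)"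
      using measurable_mono_on_nonneg[OF G'(2), of "\<lambda>\<omega>. \<bar>X 0 \<omega>\<bar>" M] by (intro nn_integral_cmult) auto
    also have "\<dots> < \<infinity>" using fin by (simp add: ennreal_mult_less_top)
    finally show "(\<Sum>k. \<integral>\<^sup>+\<omega>. f k \<bar>X 0 \<omega>\<bar> \<partial>M) < \<infinity>" .
  next
    fix k assume k: "k \<ge> n0"
    define n where "n = Suc k"
    have n: "n \<ge> n0" "n \<ge> 1" "real n > 0" using k by (auto simp: n_def)
    have Gn: "G (real n) > 0" using G'(1) by simp
    define E where "E = expectation (\<lambda>\<omega>. \<bar>trunc (b * real n) (X 0 \<omega>)\<bar> ^ (r + 1))"
    have bn: "b * real n \<ge> 0" "b * real n \<le> real n" using b n by (auto simp: mult_left_le_one_le)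
    have "{\<omega> \<in> space M. a \<le> \<bar>psum X n \<omega> / real n\<bar>} = {\<omega> \<in> space M. a * real n \<le> \<bar>\<Sum>i\<in>{1..n}. X i \<omega>\<bar>}"
      using n by (auto simp: psum_def abs_divide field_simps)
    then have "prob {\<omega> \<in> space M. a \<le> \<bar>psum X n \<omega> / real n\<bar>} \<le>
      2 * (real n * prob {\<omega> \<in> space M. b * real n < \<bar>X 0 \<omega>\<bar>} + D * (tsquare (b * real n) / real n) ^ r)"
      using tail[OF n(1,2)] by simp
    \<comment> \<open>Jensen's inequality trades the power of the truncated second moment for the
      moment \<open>E\<close>; the power of \<open>E|X|\<close> it costs is part of
      \<open>A\<close>.\<close>
    also have "\<dots> \<le> 2 * (real n * prob {\<omega> \<in> space M. b * real n < \<bar>X 0 \<omega>\<bar>} + A * E / real n ^ r)"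
    proof -
      have "D * tsquare (b * real n) ^ r / real n ^ r \<le> D * (expectation (\<lambda>\<omega>. \<bar>X 0 \<omega>\<bar>) ^ (r - 1) * E) / real n ^ r"
        unfolding E_def using D bn(1) by (intro divide_right_mono mult_left_mono tsquare_power_le[OF int(1)]) (auto simp: r_def)
      then show ?thesis by (simp add: power_divide A_def r_def mult.assoc)
    qed
    finally have "G (real n) / real n * prob {\<omega> \<in> space M. a \<le> \<bar>psum X n \<omega> / real n\<bar>} \<le>
       G (real n) / real n * (2 * (real n * prob {\<omega> \<in> space M. b * real n < \<bar>X 0 \<omega>\<bar>} + A * E / real n ^ r))"
      using Gn n by (intro mult_left_mono) auto
    also have "\<dots> = 2 * (G (real n) * prob {\<omega> \<in> space M. b * real n < \<bar>X 0 \<omega>\<bar>}) + 2 * A * (G (real n) / real n ^ (p + 2) * E)"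
      using n by (simp add: r_def field_simps)
    finally have "ennreal (G (real n) / real n * prob {\<omega> \<in> space M. a \<le> \<bar>psum X n \<omega> / real n\<bar>}) \<le>
        ennreal (2 * (G (real n) * prob {\<omega> \<in> space M. b * real n < \<bar>X 0 \<omega>\<bar>}) + 2 * A * (G (real n) / real n ^ (p + 2) * E))"
      by (rule ennreal_leI)
    also have "\<dots> = 2 * (ennreal (G (real n)) * emeasure M {\<omega> \<in> space M. b * real n < \<bar>X 0 \<omega>\<bar>}) +
        ennreal (2 * A) * (ennreal (G (real n) / real n ^ (p + 2)) * ennreal E)"
    proof -
      have "ennreal (2 * (u * v) + w * (x * z)) = 2 * (ennreal u * ennreal v) + ennreal w * (ennreal x * ennreal z)"
        if "u \<ge> 0" "v \<ge> 0" "w \<ge> 0" "x \<ge> 0" "z \<ge> 0" for u v w x z :: real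
        using that by (simp add: ennreal_plus ennreal_mult)
      moreover have "E \<ge> 0" by (simp add: E_def)
      moreover have "G (real n) / real n ^ (p + 2) \<ge> 0" using Gn by simp
      moreover have "2 * A \<ge> 0" using A by simp
      ultimately show ?thesis unfolding emeasure_eq_measure using Gn by (simp only: less_imp_le measure_nonneg)
    qed
    also have "ennreal E = (\<integral>\<^sup>+\<omega>. ennreal (\<bar>trunc (b * real n) (X 0 \<omega>)\<bar> ^ (r + 1)) \<partial>M)"
      unfolding E_def using integrable_abs[OF integrable_trunc_power[OF bn(1), of "r + 1"]]
      by (intro nn_integral_eq_integral[symmetric]) (auto simp: power_abs abs_mult)
    \<comment> \<open>Since \<open>b <= 1\<close>, the truncation level may be raised from
      \<open>b n\<close> to \<open>n\<close>.\<close>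
    also have "\<dots> \<le> (\<integral>\<^sup>+\<omega>. ennreal (\<bar>X 0 \<omega>\<bar> ^ (p + 2)) * indicator {k. \<bar>X 0 \<omega>\<bar> \<le> real (Suc k)} k \<partial>M)"
    proof (intro nn_integral_mono)
      fix \<omega>
      show "ennreal (\<bar>trunc (b * real n) (X 0 \<omega>)\<bar> ^ (r + 1)) \<le>
          ennreal (\<bar>X 0 \<omega>\<bar> ^ (p + 2)) * indicator {k. \<bar>X 0 \<omega>\<bar> \<le> real (Suc k)} k"
      proof (cases "\<bar>X 0 \<omega>\<bar> \<le> b * real n")
        case True
        then have "\<bar>X 0 \<omega>\<bar> \<le> real (Suc k)" using bn(2) unfolding n_def by (rule order_trans)
        then show ?thesis using True by (simp add: trunc_def r_def)
      qed (simp add: trunc_def r_def)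
    qed
    also have "2 * (ennreal (G (real n)) * emeasure M {\<omega> \<in> space M. b * real n < \<bar>X 0 \<omega>\<bar>}) +
        ennreal (2 * A) * (ennreal (G (real n) / real n ^ (p + 2)) *
          (\<integral>\<^sup>+\<omega>. ennreal (\<bar>X 0 \<omega>\<bar> ^ (p + 2)) * indicator {k. \<bar>X 0 \<omega>\<bar> \<le> real (Suc k)} k \<partial>M)) =
        (\<integral>\<^sup>+\<omega>. f k \<bar>X 0 \<omega>\<bar> \<partial>M)"
    proof -
      have [measurable]: "(\<lambda>\<omega>. indicator {k. \<bar>X 0 \<omega>\<bar> \<le> real (Suc k)} k :: ennreal) \<in> borel_measurable M"
        "(\<lambda>\<omega>. indicator {k. b * real (Suc k) < \<bar>X 0 \<omega>\<bar>} k :: ennreal) \<in> borel_measurable M"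
        unfolding indicator_def mem_Collect_eq by measurable
      have 1: "emeasure M {\<omega> \<in> space M. b * real n < \<bar>X 0 \<omega>\<bar>} = (\<integral>\<^sup>+\<omega>. indicator {k. b * real (Suc k) < \<bar>X 0 \<omega>\<bar>} k \<partial>M)"
      proof -
        have "(\<integral>\<^sup>+\<omega>. indicator {k. b * real (Suc k) < \<bar>X 0 \<omega>\<bar>} k \<partial>M) =
            (\<integral>\<^sup>+\<omega>. indicator {\<omega> \<in> space M. b * real n < \<bar>X 0 \<omega>\<bar>} \<omega> \<partial>M)"
          by (intro nn_integral_cong) (simp add: indicator_def n_def)
        then show ?thesis by simp
      qed
      have 2: "ennreal (G (real (Suc k)) / real (Suc k) ^ (p + 2) * t ^ (p + 2)) =
          ennreal (G (real n) / real n ^ (p + 2)) * ennreal (t ^ (p + 2))" if "t \<ge> 0" for t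
        using Gn that unfolding n_def by (intro ennreal_mult) auto
      have lin: "(\<integral>\<^sup>+\<omega>. 2 * (c1 * u \<omega>) + c2 * (c3 * v \<omega>) \<partial>M) = 2 * (c1 * (\<integral>\<^sup>+\<omega>. u \<omega> \<partial>M)) + c2 * (c3 * (\<integral>\<^sup>+\<omega>. v \<omega> \<partial>M))"
        if [measurable]: "u \<in> borel_measurable M" "v \<in> borel_measurable M" for c1 c2 c3 :: ennreal and u v
        by (subst nn_integral_add) (auto simp: nn_integral_cmult)
      have "f k \<bar>X 0 \<omega>\<bar> = 2 * (ennreal (G (real n)) * indicator {k. b * real (Suc k) < \<bar>X 0 \<omega>\<bar>} k) +
        ennreal (2 * A) * (ennreal (G (real n) / real n ^ (p + 2)) *
          (ennreal (\<bar>X 0 \<omega>\<bar> ^ (p + 2)) * indicator {k. \<bar>X 0 \<omega>\<bar> \<le> real (Suc k)} k))" for \<omega>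
        unfolding f_def 2[OF abs_ge_zero] by (simp only: n_def mult.assoc)
      then show ?thesis unfolding 1 by (simp only:) (rule lin[symmetric]; measurable)
    qed
    finally show "ennreal (G (real (Suc k)) / real (Suc k) *
      prob {\<omega> \<in> space M. a \<le> \<bar>psum X (Suc k) \<omega> / real (Suc k)\<bar>}) \<le> (\<integral>\<^sup>+\<omega>. f k \<bar>X 0 \<omega>\<bar> \<partial>M)"
      by (simp add: n_def add_mono mult_left_mono)
  qed simp
qed


section \<open>Maximal inequality and passage to the last exit time\<close>

text \<open>Independence of two disjoint coordinate blocks, phrased with predicates on restricted
  sequences so that it applies to events involving many partial sums at once.\<close>

lemma prob_restrict_indep:
  assumes "A \<inter> B = {}"
    and "{f \<in> space (PiM A (\<lambda>_. borel)). P f} \<in> sets (PiM A (\<lambda>_. borel))"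
    and "{f \<in> space (PiM B (\<lambda>_. borel)). Q f} \<in> sets (PiM B (\<lambda>_. borel))"
  shows "prob {\<omega> \<in> space M. P (restrict (\<lambda>i. X i \<omega>) A) \<and> Q (restrict (\<lambda>i. X i \<omega>) B)} =
    prob {\<omega> \<in> space M. P (restrict (\<lambda>i. X i \<omega>) A)} * prob {\<omega> \<in> space M. Q (restrict (\<lambda>i. X i \<omega>) B)}"
proof -
  define Z where "Z J \<omega> = restrict (\<lambda>i. X i \<omega>) J" for J \<omega>
  have space: "Z J \<omega> \<in> space (PiM J (\<lambda>_. borel))" for J \<omega>
    by (simp add: Z_def space_PiM)
  have "indep_var (PiM A (\<lambda>_. borel)) (Z A) (PiM B (\<lambda>_. borel)) (Z B)"
    unfolding Z_def using indep_X assms(1) by (intro indep_var_restrict[where I = UNIV]) auto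
  from indep_varD[OF this assms(2,3)]
  have "prob ((\<lambda>\<omega>. (Z A \<omega>, Z B \<omega>)) -` ({f \<in> space (PiM A (\<lambda>_. borel)). P f} \<times> {f \<in> space (PiM B (\<lambda>_. borel)). Q f}) \<inter> space M) =
    prob (Z A -` {f \<in> space (PiM A (\<lambda>_. borel)). P f} \<inter> space M) *
    prob (Z B -` {f \<in> space (PiM B (\<lambda>_. borel)). Q f} \<inter> space M)" .
  moreover have "(\<lambda>\<omega>. (Z A \<omega>, Z B \<omega>)) -` ({f \<in> space (PiM A (\<lambda>_. borel)). P f} \<times> {f \<in> space (PiM B (\<lambda>_. borel)). Q f}) \<inter> space M
      = {\<omega> \<in> space M. P (Z A \<omega>) \<and> Q (Z B \<omega>)}" using space by auto
  moreover have "Z J -` {f \<in> space (PiM J (\<lambda>_. borel)). R f} \<inter> space M = {\<omega> \<in> space M. R (Z J \<omega>)}" for J R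
    using space by auto
  ultimately show ?thesis by (simp add: Z_def)
qed

text \<open>Decomposition by the first \<open>k\<close> in \<open>K\<close> with
  \<open>|S_k| >= 2 x\<close>. The later increment is independent of this event and smaller than
  \<open>x\<close> in absolute value with probability at least \<open>1 / 2\<close>; in that case
  \<open>|S_n| >= x\<close>.\<close>

lemma ottaviani:
  assumes K: "K \<subseteq> {..n}"
    and half: "\<And>k. k \<in> K \<Longrightarrow> prob {\<omega> \<in> space M. x \<le> \<bar>\<Sum>i\<in>{k<..n}. X i \<omega>\<bar>} \<le> 1 / 2"
  shows "prob {\<omega> \<in> space M. \<exists>k\<in>K. 2 * x \<le> \<bar>psum X k \<omega>\<bar>} \<le> 2 * prob {\<omega> \<in> space M. x \<le> \<bar>psum X n \<omega>\<bar>}"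
proof -
  have finK: "finite K" using K finite_subset by blast
  define B where "B k = {\<omega> \<in> space M. 2 * x \<le> \<bar>psum X k \<omega>\<bar> \<and> (\<forall>j\<in>K. j < k \<longrightarrow> \<bar>psum X j \<omega>\<bar> < 2 * x)}" for k
  define C where "C k = {\<omega> \<in> space M. \<bar>\<Sum>i\<in>{k<..n}. X i \<omega>\<bar> < x}" for k
  have [measurable]: "B k \<in> events" for k unfolding B_def using finK by measurable
  have [measurable]: "C k \<in> events" for k unfolding C_def by measurable
  have union: "{\<omega> \<in> space M. \<exists>k\<in>K. 2 * x \<le> \<bar>psum X k \<omega>\<bar>} = (\<Union>k\<in>K. B k)"
  proof safe
    fix \<omega> k assume \<omega>: "\<omega> \<in> space M" "k \<in> K" "2 * x \<le> \<bar>psum X k \<omega>\<bar>"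
    define j where "j = (LEAST j. j \<in> K \<and> 2 * x \<le> \<bar>psum X j \<omega>\<bar>)"
    have "j \<in> K \<and> 2 * x \<le> \<bar>psum X j \<omega>\<bar>" unfolding j_def by (rule LeastI[of _ k]) (use \<omega> in simp)
    moreover have "\<bar>psum X i \<omega>\<bar> < 2 * x" if "i \<in> K" "i < j" for i
      using not_less_Least[of i "\<lambda>j. j \<in> K \<and> 2 * x \<le> \<bar>psum X j \<omega>\<bar>"] that by (auto simp: j_def)
    ultimately show "\<omega> \<in> (\<Union>k\<in>K. B k)" using \<omega>(1) by (auto simp: B_def)
  qed (auto simp: B_def)
  have disj: "disjoint_family_on B K"
    unfolding disjoint_family_on_def B_def by (auto, metis linorder_neqE_nat not_less)
  have prod: "prob (B k \<inter> C k) = prob (B k) * prob (C k)" if "k \<in> K" for k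
  proof -
    define P where "P f \<longleftrightarrow> 2 * x \<le> \<bar>\<Sum>i\<in>{1..k}. f i\<bar> \<and> (\<forall>j\<in>K. j < k \<longrightarrow> \<bar>\<Sum>i\<in>{1..j}. f i\<bar> < 2 * x)" for f :: "nat \<Rightarrow> real"
    define Q where "Q f \<longleftrightarrow> \<bar>\<Sum>i\<in>{k<..n}. f i\<bar> < x" for f :: "nat \<Rightarrow> real"
    have m: "(\<lambda>f. \<Sum>i\<in>J. f i) \<in> borel_measurable (PiM A (\<lambda>_. borel :: real measure))" if "J \<subseteq> A" for J A :: "nat set"
      using that by (intro borel_measurable_sum measurable_component_singleton) auto
    have mP: "{f \<in> space (PiM {..k} (\<lambda>_. borel)). P f} \<in> sets (PiM {..k} (\<lambda>_. borel))"
    proof -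
      have [measurable]: "(\<lambda>f. \<Sum>i\<in>{1..k}. f i) \<in> borel_measurable (PiM {..k} (\<lambda>_. borel :: real measure))"
        by (rule m) auto
      \<comment> \<open>The guard \<open>j < k\<close> keeps the sums inside the block
        \<open>{..k}\<close>; for other \<open>j\<close> the condition is vacuous.\<close>
      have [measurable]: "{f \<in> space (PiM {..k} (\<lambda>_. borel :: real measure)). j < k \<longrightarrow> \<bar>\<Sum>i\<in>{1..j}. f i\<bar> < 2 * x} \<in> sets (PiM {..k} (\<lambda>_. borel))" for j
      proof (cases "j < k")
        case True
        then have [measurable]: "(\<lambda>f. \<Sum>i\<in>{1..j}. f i) \<in> borel_measurable (PiM {..k} (\<lambda>_. borel :: real measure))"
          by (intro m) auto
        show ?thesis by measurable
      qed simp
      show ?thesis unfolding P_def using finK by measurable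
    qed
    have mQ: "{f \<in> space (PiM {k<..n} (\<lambda>_. borel)). Q f} \<in> sets (PiM {k<..n} (\<lambda>_. borel))"
    proof -
      have [measurable]: "(\<lambda>f. \<Sum>i\<in>{k<..n}. f i) \<in> borel_measurable (PiM {k<..n} (\<lambda>_. borel :: real measure))"
        by (rule m) auto
      show ?thesis unfolding Q_def by measurable
    qed
    have P: "P (restrict (\<lambda>i. X i \<omega>) {..k}) \<longleftrightarrow> 2 * x \<le> \<bar>psum X k \<omega>\<bar> \<and> (\<forall>j\<in>K. j < k \<longrightarrow> \<bar>psum X j \<omega>\<bar> < 2 * x)" for \<omega>
    proof -
      have "(\<Sum>i\<in>{1..j}. restrict (\<lambda>i. X i \<omega>) {..k} i) = psum X j \<omega>" if "j \<le> k" for j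
        unfolding psum_def using that by (intro sum.cong) auto
      then show ?thesis unfolding P_def by (metis less_imp_le order_refl)
    qed
    have Q: "Q (restrict (\<lambda>i. X i \<omega>) {k<..n}) \<longleftrightarrow> \<bar>\<Sum>i\<in>{k<..n}. X i \<omega>\<bar> < x" for \<omega>
      unfolding Q_def by simp
    have eq: "B k \<inter> C k = {\<omega> \<in> space M. P (restrict (\<lambda>i. X i \<omega>) {..k}) \<and> Q (restrict (\<lambda>i. X i \<omega>) {k<..n})}"
      "B k = {\<omega> \<in> space M. P (restrict (\<lambda>i. X i \<omega>) {..k})}"
      "C k = {\<omega> \<in> space M. Q (restrict (\<lambda>i. X i \<omega>) {k<..n})}"
      unfolding B_def C_def P Q by auto
    have "{..k} \<inter> {k<..n} = {}" by auto
    then show ?thesis by (subst eq(1), subst eq(2), subst eq(3)) (rule prob_restrict_indep[OF _ mP mQ])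
  qed
  have C: "prob (C k) \<ge> 1 / 2" if "k \<in> K" for k
  proof -
    have "C k = space M - {\<omega> \<in> space M. x \<le> \<bar>\<Sum>i\<in>{k<..n}. X i \<omega>\<bar>}" by (auto simp: C_def)
    then have "prob (C k) = 1 - prob {\<omega> \<in> space M. x \<le> \<bar>\<Sum>i\<in>{k<..n}. X i \<omega>\<bar>}"
      by (simp add: prob_compl)
    then show ?thesis using half[OF that] by simp
  qed
  have "prob (\<Union>k\<in>K. B k) = (\<Sum>k\<in>K. prob (B k))"
    using disj finK by (intro finite_measure_finite_Union) auto
  also have "\<dots> \<le> (\<Sum>k\<in>K. 2 * prob (B k \<inter> C k))"
  proof (rule sum_mono)
    fix k assume k: "k \<in> K"
    have "prob (B k) * (1 / 2) \<le> prob (B k) * prob (C k)" by (intro mult_left_mono C[OF k]) simp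
    then show "prob (B k) \<le> 2 * prob (B k \<inter> C k)" using prod[OF k] by simp
  qed
  also have "\<dots> = 2 * prob (\<Union>k\<in>K. B k \<inter> C k)"
    using disj finK by (subst finite_measure_finite_Union) (auto simp: sum_distrib_left disjoint_family_on_def)
  also have "\<dots> \<le> 2 * prob {\<omega> \<in> space M. x \<le> \<bar>psum X n \<omega>\<bar>}"
  proof (intro mult_left_mono finite_measure_mono)
    show "(\<Union>k\<in>K. B k \<inter> C k) \<subseteq> {\<omega> \<in> space M. x \<le> \<bar>psum X n \<omega>\<bar>}"
    proof safe
      fix \<omega> k assume k: "k \<in> K" and \<omega>: "\<omega> \<in> B k" "\<omega> \<in> C k"
      have eq: "{1..n} = {1..k} \<union> {k<..n}" using k K by auto
      have "psum X n \<omega> = psum X k \<omega> + (\<Sum>i\<in>{k<..n}. X i \<omega>)"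
        unfolding psum_def eq by (rule sum.union_disjoint) auto
      moreover have "2 * x \<le> \<bar>psum X k \<omega>\<bar>" "\<bar>\<Sum>i\<in>{k<..n}. X i \<omega>\<bar> < x"
        using \<omega> by (auto simp: B_def C_def)
      ultimately show "x \<le> \<bar>psum X n \<omega>\<bar>" by linarith
    qed (auto simp: B_def)
  qed auto
  finally show ?thesis unfolding union .
qed

section \<open>Covering the last exit time by dyadic blocks\<close>

text \<open>If \<open>L >= m >= 1\<close>, some \<open>n >= m\<close> with
  \<open>|S_n| >= a n\<close> lies in a block \<open>k\<close> with \<open>m <= 2 ^ Suc k\<close>,
  so a union bound over these blocks controls \<open>P(L >= m)\<close>. After exchanging sums, the
  jumps of \<open>H\<close> up to \<open>2 ^ Suc k\<close> telescope.\<close>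

lemma nn_integral_Gext_Lsup_le:
  assumes H: "\<forall>t\<ge>0. H t > 0" "mono_on {0..} H" "filterlim H at_top at_top"
  defines "A \<equiv> \<lambda>a k. {\<omega> \<in> space M. \<exists>j\<in>{2 ^ k..2 ^ Suc k}. a * 2 ^ k \<le> \<bar>psum X j \<omega>\<bar>}"
  assumes a: "a > 0"
  shows "(\<integral>\<^sup>+\<omega>. Gext H (Lsup (\<lambda>n \<omega>. psum X n \<omega> / real n) 0 a \<omega>) \<partial>M) \<le>
    ennreal (H 0) + (\<Sum>k. ennreal (H (2 ^ Suc k) * prob (A a k)))"
proof -
  define E where "E m = {\<omega> \<in> space M. enat m \<le> Lsup (\<lambda>n \<omega>. psum X n \<omega> / real n) 0 a \<omega>}" for m
  have Y: "(\<lambda>\<omega>. psum X n \<omega> / real n) \<in> borel_measurable M" for n by measurable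
  have A: "A a k \<in> events" for k unfolding A_def by measurable
  note nonneg = incr_nonneg[OF H(1,2)]
  have E: "emeasure M (E m) \<le> (\<Sum>k. emeasure M (A a k) * indicator {..2 ^ Suc k} m)" if m: "m \<ge> 1" for m
  proof -
    define A' where "A' k = (if m \<le> 2 ^ Suc k then A a k else {})" for k
    have "E m \<subseteq> (\<Union>k. A' k)"
    proof
      fix \<omega> assume \<omega>: "\<omega> \<in> E m"
      then obtain n where n: "n \<ge> m" "n \<ge> 1" "a \<le> \<bar>psum X n \<omega> / real n\<bar>"
        using m by (auto simp: E_def enat_le_Lsup_iff)
      obtain k where k: "2 ^ k \<le> n" "n < 2 ^ (k + 1)" using ex_power_ivl1[of 2 n] n by auto
      have "a * 2 ^ k \<le> a * real n"
        using k(1) a by (intro mult_left_mono) (auto simp: numeral_power_le_of_nat_cancel_iff)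
      also have "\<dots> \<le> \<bar>psum X n \<omega>\<bar>" using n by (simp add: abs_divide field_simps)
      finally have "\<omega> \<in> A a k" using k \<omega> by (auto simp: A_def E_def intro!: bexI[of _ n])
      moreover have "m \<le> 2 ^ Suc k" using k n by simp
      ultimately show "\<omega> \<in> (\<Union>k. A' k)" by (auto simp: A'_def)
    qed
    then have "emeasure M (E m) \<le> emeasure M (\<Union>k. A' k)"
      using A by (intro emeasure_mono) (auto simp: A'_def)
    also have "\<dots> \<le> (\<Sum>k. emeasure M (A' k))"
      using A by (intro emeasure_subadditive_countably) (auto simp: A'_def)
    also have "\<dots> = (\<Sum>k. emeasure M (A a k) * indicator {..2 ^ Suc k} m)"
      by (intro suminf_cong) (simp add: A'_def)
    finally show ?thesis .
  qed
  have "(\<integral>\<^sup>+\<omega>. Gext H (Lsup (\<lambda>n \<omega>. psum X n \<omega> / real n) 0 a \<omega>) \<partial>M) =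
      (\<Sum>m. ennreal (incr H m) * emeasure M (E m))"
    unfolding E_def by (rule nn_integral_Gext_Lsup[OF H Y])
  also have "\<dots> \<le> (\<Sum>m. ennreal (incr H m) * indicator {..0} m +
      (\<Sum>k. emeasure M (A a k) * (ennreal (incr H m) * indicator {..2 ^ Suc k} m)))"
  proof (intro suminf_le)
    fix m
    show "ennreal (incr H m) * emeasure M (E m) \<le> ennreal (incr H m) * indicator {..0} m +
      (\<Sum>k. emeasure M (A a k) * (ennreal (incr H m) * indicator {..2 ^ Suc k} m))"
    \<comment> \<open>The event \<open>L >= 0\<close> is certain and not covered by the blocks; it
      accounts for the term \<open>H 0\<close>.\<close>
    proof (cases "m = 0")
      case True
      have "ennreal (incr H m) * emeasure M (E m) \<le> ennreal (incr H m) * 1"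
        by (intro mult_left_mono) (auto simp: emeasure_le_1)
      then show ?thesis using True by (intro add_increasing2) auto
    next
      case False
      then have "ennreal (incr H m) * emeasure M (E m) \<le>
          ennreal (incr H m) * (\<Sum>k. emeasure M (A a k) * indicator {..2 ^ Suc k} m)"
        by (intro mult_left_mono E) auto
      also have "\<dots> = (\<Sum>k. emeasure M (A a k) * (ennreal (incr H m) * indicator {..2 ^ Suc k} m))"
        by (subst ennreal_suminf_cmult[symmetric]) (simp only: mult_ac)
      finally show ?thesis by (rule add_increasing[rotated]) simp
    qed
  qed auto
  also have "\<dots> = (\<Sum>m. ennreal (incr H m) * indicator {..0} m) +
      (\<Sum>m. \<Sum>k. emeasure M (A a k) * (ennreal (incr H m) * indicator {..2 ^ Suc k} m))"
    by (rule suminf_add[symmetric]) auto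
  also have "(\<Sum>m. ennreal (incr H m) * indicator {..0} m) = ennreal (H 0)"
    by (subst suminf_indicator_atMost) (simp add: incr_def)
  also have "(\<Sum>m. \<Sum>k. emeasure M (A a k) * (ennreal (incr H m) * indicator {..2 ^ Suc k} m)) =
      (\<Sum>k. \<Sum>m. emeasure M (A a k) * (ennreal (incr H m) * indicator {..2 ^ Suc k} m))"
    by (rule suminf_swap)
  also have "\<dots> = (\<Sum>k. ennreal (H (2 ^ Suc k) * prob (A a k)))"
  proof (rule suminf_cong)
    fix k
    have "(\<Sum>m. emeasure M (A a k) * (ennreal (incr H m) * indicator {..2 ^ Suc k} m)) =
        emeasure M (A a k) * ennreal (\<Sum>m\<le>2 ^ Suc k. incr H m)"
      by (simp only: ennreal_suminf_cmult suminf_indicator_atMost sum_ennreal nonneg)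
    also have "\<dots> = ennreal (H (2 ^ Suc k) * prob (A a k))"
      using H(1) by (simp add: sum_incr emeasure_eq_measure ennreal_mult less_imp_le mult.commute)
    finally show "(\<Sum>m. emeasure M (A a k) * (ennreal (incr H m) * indicator {..2 ^ Suc k} m)) = ennreal (H (2 ^ Suc k) * prob (A a k))" .
  qed
  finally show ?thesis .
qed

text \<open>For large \<open>k\<close> and every \<open>n\<close> in the block after block
  \<open>k\<close>, the maximal inequality bounds \<open>P(A k)\<close> by \<open>2 p(n)\<close>.
  Averaging over these \<open>n\<close> recovers the weights \<open>1 / n\<close>, and
  \<open>n >= 2 ^ Suc k\<close> gives \<open>H (2 ^ Suc k) <= H n\<close> by monotonicity.\<close>

lemma nn_integral_Gext_Lsup_finite:
  assumes H: "\<forall>t\<ge>0. H t > 0" "mono_on {0..} H" "filterlim H at_top at_top"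
    and int: "integrable M (X 0)" "expectation (X 0) = 0" and a: "a > 0"
    and fin: "(\<Sum>k. ennreal (H (real (Suc k)) / real (Suc k) *
      prob {\<omega> \<in> space M. a / 8 \<le> \<bar>psum X (Suc k) \<omega> / real (Suc k)\<bar>})) < \<infinity>"
  shows "(\<integral>\<^sup>+\<omega>. Gext H (Lsup (\<lambda>n \<omega>. psum X n \<omega> / real n) 0 a \<omega>) \<partial>M) < \<infinity>"
proof -
  define A where "A k = {\<omega> \<in> space M. \<exists>j\<in>{2 ^ k..2 ^ Suc k}. a * 2 ^ k \<le> \<bar>psum X j \<omega>\<bar>}" for k
  define p where "p n = prob {\<omega> \<in> space M. a / 8 \<le> \<bar>psum X n \<omega> / real n\<bar>}" for n
  define g where "g n = ennreal (H (real n) / real n * p n)" for n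
  define J :: "nat \<Rightarrow> nat set" where "J k = {2 ^ Suc k..<2 ^ Suc (Suc k)}" for k
  have pos: "\<And>t. t \<ge> 0 \<Longrightarrow> H t > 0" using H(1) by auto
  obtain y0 where y0: "\<And>y I. y \<ge> y0 \<Longrightarrow> finite I \<Longrightarrow> real (card I) \<le> 3 * y \<Longrightarrow>
      prob {\<omega> \<in> space M. (a / 2) * y \<le> \<bar>\<Sum>i\<in>I. X i \<omega>\<bar>} \<le> 1 / 2"
    using uniform_weak_law[OF int, of "a / 2"] a unfolding eventually_at_top_linorder by auto
  obtain k0 :: nat where k0: "y0 < 2 ^ k0" using real_arch_pow[of 2 y0] by auto
  have A_le: "prob (A k) \<le> 2 * p n" if k: "k \<ge> k0" and n: "n \<in> J k" for k n
  proof -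
    have "real (2 * 2 ^ k) \<le> real n" "real n \<le> real (4 * 2 ^ k)"
      using n unfolding of_nat_le_iff by (auto simp: J_def)
    then have n': "2 * 2 ^ k \<le> real n" "real n \<le> 4 * 2 ^ k" by simp_all
    have "2 ^ k0 \<le> (2 :: real) ^ k" using k by (intro power_increasing) auto
    with k0 have y: "y0 \<le> 2 ^ k" by linarith
    have "prob {\<omega> \<in> space M. \<exists>j\<in>{2 ^ k..2 ^ Suc k}. 2 * (a / 2 * 2 ^ k) \<le> \<bar>psum X j \<omega>\<bar>} \<le>
        2 * prob {\<omega> \<in> space M. a / 2 * 2 ^ k \<le> \<bar>psum X n \<omega>\<bar>}"
    proof (rule ottaviani)
      show "{2 ^ k..2 ^ Suc k} \<subseteq> {..n}" using n by (auto simp: J_def)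
      fix j :: nat assume "j \<in> {2 ^ k..2 ^ Suc k}"
      then have "2 ^ k \<le> j" "j \<le> n" using n by (auto simp: J_def)
      then have "real (2 ^ k) \<le> real j" by (simp only: of_nat_le_iff)
      then have "2 ^ k \<le> real j" by (simp only: of_nat_power of_nat_numeral)
      moreover have "real (card {j<..n}) = real n - real j" using \<open>j \<le> n\<close> by (simp add: of_nat_diff)
      ultimately have "real (card {j<..n}) \<le> 3 * 2 ^ k" using n' by linarith
      then show "prob {\<omega> \<in> space M. a / 2 * 2 ^ k \<le> \<bar>\<Sum>i\<in>{j<..n}. X i \<omega>\<bar>} \<le> 1 / 2"
        by (intro y0[OF y]) auto
    qed
    also have "prob {\<omega> \<in> space M. a / 2 * 2 ^ k \<le> \<bar>psum X n \<omega>\<bar>} \<le> p n"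
      unfolding p_def
    proof (intro finite_measure_mono subsetI)
      fix \<omega> assume \<omega>: "\<omega> \<in> {\<omega> \<in> space M. a / 2 * 2 ^ k \<le> \<bar>psum X n \<omega>\<bar>}"
      have npos: "real n > 0" using n'(1) zero_less_power[of "2::real" k] by linarith
      \<comment> \<open>Origin of the 8: halving in the maximal inequality, and
        \<open>n <= 4 * 2 ^ k\<close>.\<close>
      have "a / 8 * real n \<le> a / 8 * (4 * 2 ^ k)" using n' a by (intro mult_left_mono) auto
      also have "\<dots> \<le> \<bar>psum X n \<omega>\<bar>" using \<omega> by simp
      finally show "\<omega> \<in> {\<omega> \<in> space M. a / 8 \<le> \<bar>psum X n \<omega> / real n\<bar>}"
        using \<omega> npos by (simp add: abs_divide field_simps)
    qed measurable
    finally show ?thesis by (simp add: A_def)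
  qed
  have "(\<Sum>k. ennreal (H (2 ^ Suc k) * prob (A k))) < \<infinity>"
  proof (rule suminf_ennreal_finite_if_eventually_le)
    fix k assume k: "k \<ge> k0"
    \<comment> \<open>The block \<open>J k\<close> has \<open>2 ^ Suc k\<close> elements, so the
      term is spread evenly over it. The factor 4 below combines the 2 of the maximal inequality
      with \<open>1 / 2 ^ Suc k <= 2 / n\<close>.\<close>
    have "H (2 ^ Suc k) * prob (A k) = (\<Sum>n\<in>J k. H (2 ^ Suc k) * prob (A k) / 2 ^ Suc k)"
      by (simp add: J_def)
    also have "\<dots> \<le> (\<Sum>n\<in>J k. 4 * (H (real n) / real n * p n))"
    proof (rule sum_mono)
      fix n assume n: "n \<in> J k"
      have "real (2 ^ Suc k) \<le> real n" "real n \<le> real (2 * 2 ^ Suc k)"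
        using n unfolding of_nat_le_iff by (auto simp: J_def)
      then have n': "2 ^ Suc k \<le> real n" "real n \<le> 2 * 2 ^ Suc k" by simp_all
      have 1: "H (2 ^ Suc k) * prob (A k) \<le> H (real n) * (2 * p n)"
        using n' A_le[OF k n] pos by (intro mult_mono mono_onD[OF H(2)]) (auto simp: less_imp_le)
      have 2: "1 / 2 ^ Suc k \<le> 2 / real n"
        using n' order_less_le_trans[OF zero_less_power[of "2::real" "Suc k"] n'(1)] by (simp add: field_simps)
      have "H (2 ^ Suc k) * prob (A k) * (1 / 2 ^ Suc k) \<le> H (real n) * (2 * p n) * (2 / real n)"
        using pos by (intro mult_mono[OF 1 2]) (auto simp: p_def less_imp_le)
      then show "H (2 ^ Suc k) * prob (A k) / 2 ^ Suc k \<le> 4 * (H (real n) / real n * p n)" by simp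
    qed
    finally have "ennreal (H (2 ^ Suc k) * prob (A k)) \<le> ennreal (\<Sum>n\<in>J k. 4 * (H (real n) / real n * p n))"
      by (rule ennreal_leI)
    also have "\<dots> = (\<Sum>n\<in>J k. 4 * g n)"
    proof -
      have nonneg: "H (real n) / real n * p n \<ge> 0" for n
        using pos[of "real n"] by (simp add: p_def)
      then have "4 * g n = ennreal (4 * (H (real n) / real n * p n))" for n
        by (simp only: g_def ennreal_mult ennreal_numeral zero_le_numeral)
      then show ?thesis using nonneg by (simp only: sum_ennreal mult_nonneg_nonneg zero_le_numeral)
    qed
    also have "\<dots> = (\<Sum>n. 4 * (g n * indicator (J k) n))"
      by (subst suminf_finite[where N = "J k"]) (auto simp: J_def intro!: sum.cong)
    finally show "ennreal (H (2 ^ Suc k) * prob (A k)) \<le> (\<Sum>n. 4 * (g n * indicator (J k) n))" .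
  next
    have disj: "disjoint_family J"
    proof -
      have "J i \<inter> J k = {}" if "i < k" for i k
      proof -
        have "(2::nat) ^ Suc (Suc i) \<le> 2 ^ Suc k" using that by (intro power_increasing) auto
        then show ?thesis by (auto simp: J_def)
      qed
      then show ?thesis unfolding disjoint_family_on_def by (metis Int_commute linorder_neqE_nat)
    qed
    have "(\<Sum>k. \<Sum>n. 4 * (g n * indicator (J k) n)) = (\<Sum>n. \<Sum>k. 4 * (g n * indicator (J k) n))"
      by (rule suminf_swap)
    also have "\<dots> = (\<Sum>n. 4 * (g n * indicator (\<Union>k. J k) n))"
      by (simp only: ennreal_suminf_cmult suminf_indicator[OF disj])
    also have "\<dots> \<le> (\<Sum>n. 4 * g n)"
      by (intro suminf_le) (auto simp: indicator_def)
    also have "\<dots> = 4 * (\<Sum>k. g (Suc k))"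
    proof -
      have "(\<Sum>k. g (Suc k)) = (\<Sum>n. g n)"
      proof (rule antisym)
        \<comment> \<open>Division by 0 yields 0, so the series may start at either index.\<close>
        have "g 0 = 0" by (simp add: g_def)
        show "(\<Sum>n. g n) \<le> (\<Sum>k. g (Suc k))"
        proof (rule suminf_le_const)
          fix N
          have "(\<Sum>n<N. g n) \<le> (\<Sum>n<Suc N. g n)" by simp
          also have "\<dots> = (\<Sum>k<N. g (Suc k))"
            by (simp only: sum.lessThan_Suc_shift \<open>g 0 = 0\<close> add_0_left)
          also have "\<dots> \<le> (\<Sum>k. g (Suc k))" by (intro sum_le_suminf) auto
          finally show "(\<Sum>n<N. g n) \<le> (\<Sum>k. g (Suc k))" .
        qed simp
      qed (rule suminf_Suc_le)
      then show ?thesis by simp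
    qed
    also have "\<dots> < \<infinity>"
      using fin by (simp add: g_def p_def ennreal_mult_less_top)
    finally show "(\<Sum>k. \<Sum>n. 4 * (g n * indicator (J k) n)) < \<infinity>" .
  qed simp
  then have "ennreal (H 0) + (\<Sum>k. ennreal (H (2 ^ Suc k) * prob (A k))) < \<infinity>" by simp
  with nn_integral_Gext_Lsup_le[OF H a] show ?thesis unfolding A_def by (rule le_less_trans)
qed

end

lemma norm_le_norm_of_nonneg:
  fixes u v :: real
  shows "0 \<le> u \<Longrightarrow> u \<le> v \<Longrightarrow> norm u \<le> norm v"
  by simp

context iid_rv
begin

section \<open>The equivalences for moderate functions\<close>

lemma integrable_times_iff:
  assumes "\<forall>t\<ge>0. H t > 0" "mono_on {0..} H"
  shows "integrable M (\<lambda>\<omega>. \<bar>X 0 \<omega>\<bar> * H \<bar>X 0 \<omega>\<bar>) \<longleftrightarrow> (\<integral>\<^sup>+\<omega>. ennreal (\<bar>X 0 \<omega>\<bar> * H \<bar>X 0 \<omega>\<bar>) \<partial>M) < \<infinity>"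
proof -
  have [measurable]: "(\<lambda>\<omega>. H \<bar>X 0 \<omega>\<bar>) \<in> borel_measurable M"
    by (rule measurable_mono_on_nonneg[OF assms(2)]) auto
  have "norm (\<bar>X 0 \<omega>\<bar> * H \<bar>X 0 \<omega>\<bar>) = \<bar>X 0 \<omega>\<bar> * H \<bar>X 0 \<omega>\<bar>" for \<omega>
    using assms(1) by (simp add: abs_mult less_imp_le)
  then show ?thesis by (simp add: integrable_iff_bounded)
qed

lemma integrable_if_Gext_Lsup_finite:
  assumes H: "\<forall>t\<ge>0. H t > 0" "mono_on {0..} H" "filterlim H at_top at_top"
    and fin: "(\<integral>\<^sup>+\<omega>. Gext H (Lsup (\<lambda>n \<omega>. psum X n \<omega> / real n) 0 (1 / 8) \<omega>) \<partial>M) < \<infinity>"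
  shows "integrable M (\<lambda>\<omega>. \<bar>X 0 \<omega>\<bar> * H \<bar>X 0 \<omega>\<bar>)"
  unfolding integrable_times_iff[OF H(1,2)]
proof (rule le_less_trans)
  show "(\<integral>\<^sup>+\<omega>. ennreal (\<bar>X 0 \<omega>\<bar> * H \<bar>X 0 \<omega>\<bar>) \<partial>M) \<le> (\<integral>\<^sup>+\<omega>. ennreal (\<bar>X 0 \<omega>\<bar> * H (2 * \<bar>X 0 \<omega>\<bar>)) \<partial>M)"
    by (intro nn_integral_mono ennreal_leI mult_left_mono mono_onD[OF H(2)]) auto
qed (rule nn_integral_abs_times_finite[OF H fin])

lemma equivalences_centered:
  assumes G: "moderate G" and int: "integrable M (X 0)" "expectation (X 0) = 0"
  defines "SA \<equiv> integrable M (\<lambda>\<omega>. \<bar>X 0 \<omega>\<bar> * G \<bar>X 0 \<omega>\<bar>)"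
    and "SB \<equiv> \<forall>a>0. summable (\<lambda>n. G (real (Suc n)) / real (Suc n) *
                  measure M {\<omega> \<in> space M. \<bar>psum X (Suc n) \<omega> / real (Suc n)\<bar> \<ge> a})"
    and "SC \<equiv> \<forall>a>0. (\<integral>\<^sup>+ \<omega>. Gext G (Lsup (\<lambda>n \<omega>. psum X n \<omega> / real n) 0 a \<omega>) \<partial>M) < \<infinity>"
  shows "SA \<longleftrightarrow> SB" "SB \<longleftrightarrow> SC"
proof -
  have G': "\<forall>t\<ge>0. G t > 0" "mono_on {0..} G" "filterlim G at_top at_top"
    using G by (auto simp: moderate_def)
  have nonneg: "G (real (Suc n)) / real (Suc n) *
      prob {\<omega> \<in> space M. a \<le> \<bar>psum X (Suc n) \<omega> / real (Suc n)\<bar>} \<ge> 0" for a n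
    using G'(1) by (simp add: less_imp_le divide_nonneg_nonneg)
  have "SB" if "SA"
    unfolding SB_def
  proof (intro allI impI)
    fix a :: real assume "a > 0"
    have "(\<integral>\<^sup>+\<omega>. ennreal (\<bar>X 0 \<omega>\<bar> * G \<bar>X 0 \<omega>\<bar>) \<partial>M) < \<infinity>"
      using that unfolding SA_def integrable_times_iff[OF G'(1,2)] .
    from suminf_prob_mean_ge_finite[OF G int \<open>a > 0\<close> this]
    show "summable (\<lambda>n. G (real (Suc n)) / real (Suc n) *
        prob {\<omega> \<in> space M. a \<le> \<bar>psum X (Suc n) \<omega> / real (Suc n)\<bar>})"
      by (intro summable_suminf_not_top nonneg) auto
  qed
  moreover have "SC" if "SB"
    unfolding SC_def
  proof (intro allI impI)
    fix a :: real assume a: "a > 0"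
    then have "a / 8 > 0" by simp
    then have "summable (\<lambda>n. G (real (Suc n)) / real (Suc n) *
        prob {\<omega> \<in> space M. a / 8 \<le> \<bar>psum X (Suc n) \<omega> / real (Suc n)\<bar>})"
      using that unfolding SB_def by blast
    from ennreal_suminf_neq_top[OF this nonneg]
    show "(\<integral>\<^sup>+ \<omega>. Gext G (Lsup (\<lambda>n \<omega>. psum X n \<omega> / real n) 0 a \<omega>) \<partial>M) < \<infinity>"
      by (intro nn_integral_Gext_Lsup_finite[OF G' int a]) (simp add: less_top)
  qed
  moreover have "SA" if "SC"
    unfolding SA_def using that unfolding SC_def by (intro integrable_if_Gext_Lsup_finite[OF G']) auto
  ultimately show "SA \<longleftrightarrow> SB" "SB \<longleftrightarrow> SC" by blast+
qed

text \<open>The two means agree for \<open>n >= 1\<close>, the only indices that \<open>Lsup\<close>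
  tests. At \<open>n = 0\<close> division by zero yields 0 and the identity would fail for nonzero
  \<open>x\<close>.\<close>

lemma Lsup_shift:
  "Lsup (\<lambda>n \<omega>. psum X n \<omega> / real n) x a \<omega> = Lsup (\<lambda>n \<omega>. psum (\<lambda>n \<omega>. X n \<omega> - x) n \<omega> / real n) 0 a \<omega>"
proof -
  have "psum X n \<omega> / real n - x = psum (\<lambda>n \<omega>. X n \<omega> - x) n \<omega> / real n - 0" if "n \<ge> 1" for n
    using that by (simp add: psum_def sum_subtractf field_simps)
  then have "{enat n |n. n \<ge> 1 \<and> a \<le> \<bar>psum X n \<omega> / real n - x\<bar>} =
      {enat n |n. n \<ge> 1 \<and> a \<le> \<bar>psum (\<lambda>n \<omega>. X n \<omega> - x) n \<omega> / real n - 0\<bar>}"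
    by (metis (no_types, lifting))
  then show ?thesis unfolding Lsup_def by simp
qed

text \<open>Given convergence to \<open>x\<close>, the moment bound is applied to
  \<open>X n - x\<close>, and \<open>x\<close> is added back at the cost of constants. Conversely
  the moment condition makes \<open>X\<close> integrable because \<open>G >= G 0 > 0\<close>, and
  its mean serves as the limit.\<close>

lemma G_converges_iff:
  assumes G: "moderate G"
  shows "(\<exists>x. G_converges_to M G (\<lambda>n \<omega>. psum X n \<omega> / real n) x) \<longleftrightarrow>
    integrable M (\<lambda>\<omega>. \<bar>X 0 \<omega>\<bar> * G \<bar>X 0 \<omega>\<bar>)"
proof -
  have G': "\<forall>t\<ge>0. G t > 0" "mono_on {0..} G" "filterlim G at_top at_top"
    using G by (auto simp: moderate_def)
  have [measurable]: "(\<lambda>\<omega>. G \<bar>X 0 \<omega> - x\<bar>) \<in> borel_measurable M" for x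
    by (rule measurable_mono_on_nonneg[OF G'(2)]) auto
  have [measurable]: "(\<lambda>\<omega>. G \<bar>X 0 \<omega>\<bar>) \<in> borel_measurable M"
    by (rule measurable_mono_on_nonneg[OF G'(2)]) auto
  obtain C where C: "C \<ge> 0" "\<And>u v. \<bar>u + v\<bar> * G \<bar>u + v\<bar> \<le> C * (\<bar>u\<bar> * G \<bar>u\<bar> + \<bar>v\<bar> * G \<bar>v\<bar>)"
    using times_moderate_add_le[OF G] by metis
  have nonneg: "\<bar>u\<bar> * G \<bar>u\<bar> \<ge> 0" for u
    using G'(1) by (simp add: less_imp_le)
  have shift: "iid_rv M (\<lambda>n \<omega>. X n \<omega> - x)" for x by (rule iid_rv_compose) simp
  show ?thesis
  proof
    assume "\<exists>x. G_converges_to M G (\<lambda>n \<omega>. psum X n \<omega> / real n) x"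
    then obtain x where "G_converges_to M G (\<lambda>n \<omega>. psum X n \<omega> / real n) x" ..
    then have "(\<integral>\<^sup>+ \<omega>. Gext G (Lsup (\<lambda>n \<omega>. psum X n \<omega> / real n) x (1 / 8) \<omega>) \<partial>M) < \<infinity>"
      by (simp add: G_converges_to_def)
    then have "integrable M (\<lambda>\<omega>. \<bar>X 0 \<omega> - x\<bar> * G \<bar>X 0 \<omega> - x\<bar>)"
      unfolding Lsup_shift by (rule iid_rv.integrable_if_Gext_Lsup_finite[OF shift G'])
    then have "integrable M (\<lambda>\<omega>. C * (\<bar>X 0 \<omega> - x\<bar> * G \<bar>X 0 \<omega> - x\<bar> + \<bar>x\<bar> * G \<bar>x\<bar>))" by simp
    then show "integrable M (\<lambda>\<omega>. \<bar>X 0 \<omega>\<bar> * G \<bar>X 0 \<omega>\<bar>)"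
    proof (rule Bochner_Integration.integrable_bound)
      have "\<bar>X 0 \<omega>\<bar> * G \<bar>X 0 \<omega>\<bar> \<le> C * (\<bar>X 0 \<omega> - x\<bar> * G \<bar>X 0 \<omega> - x\<bar> + \<bar>x\<bar> * G \<bar>x\<bar>)" for \<omega>
        using C(2)[of "X 0 \<omega> - x" x] by simp
      then show "AE \<omega> in M. norm (\<bar>X 0 \<omega>\<bar> * G \<bar>X 0 \<omega>\<bar>) \<le> norm (C * (\<bar>X 0 \<omega> - x\<bar> * G \<bar>X 0 \<omega> - x\<bar> + \<bar>x\<bar> * G \<bar>x\<bar>))"
        by (intro AE_I2 norm_le_norm_of_nonneg nonneg)
    qed measurable
  next
    assume I: "integrable M (\<lambda>\<omega>. \<bar>X 0 \<omega>\<bar> * G \<bar>X 0 \<omega>\<bar>)"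
    have "integrable M (\<lambda>\<omega>. (1 / G 0) * (\<bar>X 0 \<omega>\<bar> * G \<bar>X 0 \<omega>\<bar>))" using I by simp
    then have int: "integrable M (X 0)"
    proof (rule Bochner_Integration.integrable_bound)
      have "\<bar>X 0 \<omega>\<bar> \<le> (1 / G 0) * (\<bar>X 0 \<omega>\<bar> * G \<bar>X 0 \<omega>\<bar>)" for \<omega>
      proof -
        have "\<bar>X 0 \<omega>\<bar> * G 0 \<le> \<bar>X 0 \<omega>\<bar> * G \<bar>X 0 \<omega>\<bar>"
          by (intro mult_left_mono mono_onD[OF G'(2)]) auto
        then show ?thesis using G'(1) by (simp add: field_simps)
      qed
      then show "AE \<omega> in M. norm (X 0 \<omega>) \<le> norm ((1 / G 0) * (\<bar>X 0 \<omega>\<bar> * G \<bar>X 0 \<omega>\<bar>))"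
        by (intro AE_I2) (metis abs_ge_self order_trans real_norm_def)
    qed simp
    define x where "x = expectation (X 0)"
    interpret S: iid_rv M "\<lambda>n \<omega>. X n \<omega> - x" by (rule shift)
    have int': "integrable M (\<lambda>\<omega>. X 0 \<omega> - x)" "expectation (\<lambda>\<omega>. X 0 \<omega> - x) = 0"
      using int by (simp_all add: x_def prob_space)
    have "integrable M (\<lambda>\<omega>. C * (\<bar>X 0 \<omega>\<bar> * G \<bar>X 0 \<omega>\<bar> + \<bar>- x\<bar> * G \<bar>- x\<bar>))" using I by simp
    then have I': "integrable M (\<lambda>\<omega>. \<bar>X 0 \<omega> - x\<bar> * G \<bar>X 0 \<omega> - x\<bar>)"
    proof (rule Bochner_Integration.integrable_bound)
      have "\<bar>X 0 \<omega> - x\<bar> * G \<bar>X 0 \<omega> - x\<bar> \<le> C * (\<bar>X 0 \<omega>\<bar> * G \<bar>X 0 \<omega>\<bar> + \<bar>- x\<bar> * G \<bar>- x\<bar>)" for \<omega>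
        using C(2)[of "X 0 \<omega>" "- x"] by simp
      then show "AE \<omega> in M. norm (\<bar>X 0 \<omega> - x\<bar> * G \<bar>X 0 \<omega> - x\<bar>) \<le> norm (C * (\<bar>X 0 \<omega>\<bar> * G \<bar>X 0 \<omega>\<bar> + \<bar>- x\<bar> * G \<bar>- x\<bar>))"
        by (intro AE_I2 norm_le_norm_of_nonneg nonneg)
    qed measurable
    have "\<forall>a>0. (\<integral>\<^sup>+ \<omega>. Gext G (Lsup (\<lambda>n \<omega>. psum X n \<omega> / real n) x a \<omega>) \<partial>M) < \<infinity>"
      unfolding Lsup_shift using S.equivalences_centered[OF G int'] I' by simp
    moreover have "(\<lambda>\<omega>. Gext G (Lsup (\<lambda>n \<omega>. psum X n \<omega> / real n) x a \<omega>)) \<in> borel_measurable M" for a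
      by (rule measurable_Gext_Lsup[OF G']) measurable
    ultimately have "G_converges_to M G (\<lambda>n \<omega>. psum X n \<omega> / real n) x"
      by (simp add: G_converges_to_def)
    then show "\<exists>x. G_converges_to M G (\<lambda>n \<omega>. psum X n \<omega> / real n) x" ..
  qed
qed

end

section \<open>Necessity of the doubling condition\<close>

text \<open>Canonical model: the coordinates of an infinite product have the product itself as joint
  law, which is independence.\<close>

lemma iid_seq_PiM:
  fixes \<nu> :: "real measure"
  assumes \<nu>: "prob_space \<nu>" "sets \<nu> = sets borel"
  defines "N \<equiv> PiM UNIV (\<lambda>_::nat. \<nu>)"
  shows "prob_space N" "iid_seq N (\<lambda>n \<omega>. \<omega> n)" "distr N borel (\<lambda>\<omega>. \<omega> n) = \<nu>"
proof -
  interpret prob_space N unfolding N_def by (rule prob_space_PiM[OF \<nu>(1)])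
  have distr: "distr N borel (\<lambda>\<omega>. \<omega> n) = \<nu>" for n
  proof -
    have "distr N \<nu> (\<lambda>\<omega>. \<omega> n) = \<nu>"
      unfolding N_def using \<nu>(1) by (intro distr_PiM_component) auto
    then show ?thesis using distr_cong[OF refl \<nu>(2)[symmetric] refl, of N "\<lambda>\<omega>. \<omega> n"] by simp
  qed
  have sets: "sets N = sets (PiM UNIV (\<lambda>_. borel))"
    unfolding N_def using \<nu>(2) by (intro sets_PiM_cong) auto
  have rv: "(\<lambda>\<omega>. \<omega> n) \<in> borel_measurable N" for n
    unfolding measurable_cong_sets[OF sets refl] by measurable
  have "indep_vars (\<lambda>_. borel) (\<lambda>n \<omega>. \<omega> n) UNIV"
  proof (subst indep_vars_iff_distr_eq_PiM)
    show "distr N (PiM UNIV (\<lambda>_. borel)) (\<lambda>x. \<lambda>i\<in>UNIV. x i) = PiM UNIV (\<lambda>i. distr N borel (\<lambda>\<omega>. \<omega> i))"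
      unfolding distr using distr_id2[OF sets[symmetric]] by (simp add: N_def restrict_UNIV)
  qed (use rv in auto)
  then show "prob_space N" "iid_seq N (\<lambda>n \<omega>. \<omega> n)" "distr N borel (\<lambda>\<omega>. \<omega> n) = \<nu>"
    using distr prob_space_axioms by (simp_all add: iid_seq_def)
qed

text \<open>Otherwise the doubling ratio would be below \<open>K\<close> from \<open>T\<close> on,
  and for smaller arguments it is at most \<open>H (2 * max T 0) / H 0\<close>; being bounded
  throughout, it would make \<open>H\<close> moderate.\<close>

lemma not_moderate_doubling:
  assumes H: "\<forall>t\<ge>0. H t > 0" "mono_on {0..} H" "filterlim H at_top at_top" "\<not> moderate H"
  obtains t where "t \<ge> T" "H (2 * t) \<ge> K * H t"
proof -
  have "\<exists>t\<ge>T. H (2 * t) \<ge> K * H t"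
  proof (rule ccontr)
    assume "\<not> ?thesis"
    then have *: "\<And>t. t \<ge> T \<Longrightarrow> H (2 * t) < K * H t" by (meson not_le)
    have "H (2 * t) / H t \<le> max K (H (2 * max T 0) / H 0)" if t: "t > 0" for t
    proof (cases "t \<ge> T")
      case True
      then have "H (2 * t) / H t \<le> K" using *[OF True] H(1) t by (simp add: divide_simps) 
      then show ?thesis by simp
    next
      case False
      have "H (2 * t) / H t \<le> H (2 * max T 0) / H 0"
        using H(1) t False by (intro frac_le mono_onD[OF H(2)]) (auto simp: less_imp_le)
      then show ?thesis by simp
    qed
    then have "moderate H" using H unfolding moderate_def by blast
    with H(4) show False by simp
  qed
  then show ?thesis using that by blast
qed

text \<open>The value is \<open>\<plusminus> t k\<close> with probability \<open>q k / 2\<close> each, where \<open>k\<close> is geometric, and \<open>0\<close> otherwise: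
  the atom at \<open>0\<close> spares a normalisation.\<close>

definition sparse_pmf :: "(nat \<Rightarrow> real) \<Rightarrow> (nat \<Rightarrow> real) \<Rightarrow> real pmf" where
  "sparse_pmf t q = bind_pmf (geometric_pmf (1 / 2)) (\<lambda>k. bind_pmf (bernoulli_pmf (q k)) (\<lambda>b.
     bind_pmf (bernoulli_pmf (1 / 2)) (\<lambda>s. return_pmf (if b then (if s then t k else - t k) else 0))))"

lemma nn_integral_sparse_pmf:
  assumes q: "\<And>k. 0 \<le> q k" "\<And>k. q k \<le> 1" and f: "f 0 = 0"
  shows "(\<integral>\<^sup>+x. f x \<partial>measure_pmf (sparse_pmf t q)) =
    (\<Sum>k. ennreal ((1 / 2) ^ Suc k * q k) * (ennreal (1 / 2) * f (t k) + ennreal (1 / 2) * f (- t k)))"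
proof -
  have "(\<integral>\<^sup>+x. f x \<partial>measure_pmf (sparse_pmf t q)) =
    (\<integral>\<^sup>+k. ennreal (q k) * (ennreal (1 / 2) * f (t k) + ennreal (1 / 2) * f (- t k)) \<partial>measure_pmf (geometric_pmf (1 / 2)))"
    unfolding sparse_pmf_def using q f
    by (simp add: nn_integral_bernoulli_pmf mult.commute ennreal_plus)
  also have "\<dots> = (\<Sum>k. ennreal ((1 / 2) ^ Suc k) * (ennreal (q k) * (ennreal (1 / 2) * f (t k) + ennreal (1 / 2) * f (- t k))))"
    by (simp add: nn_integral_measure_pmf nn_integral_count_space_nat mult.commute)
  also have "\<dots> = (\<Sum>k. ennreal ((1 / 2) ^ Suc k * q k) * (ennreal (1 / 2) * f (t k) + ennreal (1 / 2) * f (- t k)))"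
    using q by (intro suminf_cong) (simp only: ennreal_mult mult.assoc zero_le_power zero_le_divide_1_iff zero_le_numeral)
  finally show ?thesis .
qed

text \<open>The masses make level \<open>k\<close> contribute \<open>1 / 2 ^ Suc k\<close> to
  \<open>E[|Y| H(|Y|)]\<close>, but at least \<open>1 / 2\<close> to \<open>E[|Y| H(2 |Y|)]\<close>.
  Finiteness of \<open>E[H(L)]\<close> at \<open>a = 1 / 8\<close> would make the latter
  finite.\<close>

lemma not_moderate_counterexample:
  assumes H: "\<forall>t\<ge>0. H t > 0" "mono_on {0..} H" "filterlim H at_top at_top" "\<not> moderate H"
  obtains N :: "(nat \<Rightarrow> real) measure" and Y :: "nat \<Rightarrow> (nat \<Rightarrow> real) \<Rightarrow> real"
  where "prob_space N" "iid_seq N Y" "integrable N (Y 0)" "prob_space.expectation N (Y 0) = 0"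
    "integrable N (\<lambda>\<omega>. \<bar>Y 0 \<omega>\<bar> * H \<bar>Y 0 \<omega>\<bar>)"
    "\<not> (\<integral>\<^sup>+ \<omega>. Gext H (Lsup (\<lambda>n \<omega>. psum Y n \<omega> / real n) 0 (1 / 8) \<omega>) \<partial>N) < \<infinity>"
proof -
  \<comment> \<open>The lower bound \<open>1 / H 0\<close> ensures
    \<open>t k * H (t k) >= 1\<close>, so that \<open>q k\<close> is a probability.\<close>
  have "\<exists>t. t \<ge> max 1 (1 / H 0) \<and> H (2 * t) \<ge> 2 ^ k * H t" for k :: nat
    using not_moderate_doubling[OF H] by metis
  then obtain t where t: "\<And>k. t k \<ge> max 1 (1 / H 0)" "\<And>k. H (2 * t k) \<ge> 2 ^ k * H (t k)" by metis
  have H0: "H 0 > 0" using H(1) by simp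
  have t1: "t k \<ge> 1" "t k * H 0 \<ge> 1" "t k > 0" for k
    using t(1)[of k] H0 by (auto simp: field_simps)
  have Ht: "H (t k) \<ge> H 0" "H (t k) > 0" for k
    using t1(3)[of k] H(1) by (auto intro!: mono_onD[OF H(2)] simp: less_imp_le)
  define q where "q k = 1 / (t k * H (t k))" for k
  have q: "0 \<le> q k" "q k \<le> 1" for k
  proof -
    have "t k * H 0 \<le> t k * H (t k)" using t1(3)[of k] Ht(1)[of k] by (intro mult_left_mono) auto
    with t1(2)[of k] have "1 \<le> t k * H (t k)" by (rule order_trans)
    then show "0 \<le> q k" "q k \<le> 1" by (auto simp: q_def)
  qed
  define \<nu> where "\<nu> = distr (measure_pmf (sparse_pmf t q)) borel (\<lambda>x. x)"
  define N where "N = PiM UNIV (\<lambda>_::nat. \<nu>)"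
  define Y where "Y n \<omega> = \<omega> n" for n and \<omega> :: "nat \<Rightarrow> real"
  have \<nu>: "prob_space \<nu>" "sets \<nu> = sets borel"
    unfolding \<nu>_def by (auto intro!: prob_space.prob_space_distr prob_space_measure_pmf)
  have N: "prob_space N" "iid_seq N Y" "distr N borel (Y 0) = \<nu>"
    unfolding N_def Y_def using iid_seq_PiM[OF \<nu>] by auto
  interpret iid_rv N Y using N(1,2) by (intro iid_rv.intro iid_rv_axioms.intro)
  have nn: "(\<integral>\<^sup>+\<omega>. f (Y 0 \<omega>) \<partial>N) =
      (\<Sum>k. ennreal ((1 / 2) ^ Suc k * q k) * (ennreal (1 / 2) * f (t k) + ennreal (1 / 2) * f (- t k)))"
    if "f \<in> borel_measurable borel" "f 0 = 0" for f :: "real \<Rightarrow> ennreal"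
  proof -
    have "(\<integral>\<^sup>+\<omega>. f (Y 0 \<omega>) \<partial>N) = (\<integral>\<^sup>+x. f x \<partial>\<nu>)"
      unfolding N(3)[symmetric] using that by (subst nn_integral_distr) auto
    also have "\<dots> = (\<integral>\<^sup>+x. f x \<partial>measure_pmf (sparse_pmf t q))"
      unfolding \<nu>_def using that by (subst nn_integral_distr) auto
    finally show ?thesis using nn_integral_sparse_pmf[where q = q and t = t and f = f, OF q that(2)] by simp
  qed
  \<comment> \<open>The factor \<open>t k\<close> cancels against \<open>q k\<close>. One formula
    thus serves three moments, with \<open>h\<close> the constant 1, \<open>H\<close> itself, and
    \<open>H\<close> at the doubled argument.\<close>
  have nn_abs: "(\<integral>\<^sup>+\<omega>. ennreal (\<bar>Y 0 \<omega>\<bar> * h \<bar>Y 0 \<omega>\<bar>) \<partial>N) = (\<Sum>k. ennreal ((1 / 2) ^ Suc k * (h (t k) / H (t k))))"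
    if h: "mono_on {0..} h" "\<And>t. t \<ge> 0 \<Longrightarrow> h t \<ge> 0" for h
  proof -
    have [measurable]: "(\<lambda>x::real. h \<bar>x\<bar>) \<in> borel_measurable borel"
      by (rule measurable_mono_on_nonneg[OF h(1)]) auto
    have "(\<integral>\<^sup>+\<omega>. ennreal (\<bar>Y 0 \<omega>\<bar> * h \<bar>Y 0 \<omega>\<bar>) \<partial>N) = (\<Sum>k. ennreal ((1 / 2) ^ Suc k * q k) *
        (ennreal (1 / 2) * ennreal (\<bar>t k\<bar> * h \<bar>t k\<bar>) + ennreal (1 / 2) * ennreal (\<bar>- t k\<bar> * h \<bar>- t k\<bar>)))"
      by (rule nn) measurable
    also have "\<dots> = (\<Sum>k. ennreal ((1 / 2) ^ Suc k * (h (t k) / H (t k))))"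
    proof (rule suminf_cong)
      fix k
      have *: "ennreal (1 / 2) * ennreal u + ennreal (1 / 2) * ennreal u = ennreal u" if "u \<ge> 0" for u
      proof -
        have "ennreal (1 / 2) * ennreal u + ennreal (1 / 2) * ennreal u = ennreal (1 / 2 * u + 1 / 2 * u)"
          using that by (simp only: ennreal_mult ennreal_plus mult_nonneg_nonneg zero_le_divide_1_iff zero_le_numeral)
        then show ?thesis by simp
      qed
      have "ennreal ((1 / 2) ^ Suc k * q k) * ennreal (t k * h (t k)) = ennreal (((1 / 2) ^ Suc k * q k) * (t k * h (t k)))"
        using q[of k] t1[of k] h(2)[of "t k"] by (intro ennreal_mult[symmetric]) auto
      also have "((1 / 2) ^ Suc k * q k) * (t k * h (t k)) = (1 / 2) ^ Suc k * (h (t k) / H (t k))"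
        using t1(3)[of k] by (simp add: q_def)
      finally show "ennreal ((1 / 2) ^ Suc k * q k) *
        (ennreal (1 / 2) * ennreal (\<bar>t k\<bar> * h \<bar>t k\<bar>) + ennreal (1 / 2) * ennreal (\<bar>- t k\<bar> * h \<bar>- t k\<bar>)) =
        ennreal ((1 / 2) ^ Suc k * (h (t k) / H (t k)))"
        using t1(3)[of k] h(2)[of "t k"] * by simp
    qed
    finally show ?thesis .
  qed
  have geom: "(\<Sum>k. ennreal ((1 / 2) ^ Suc k * c)) < \<infinity>" if "c \<ge> 0" for c
  proof -
    have "summable (\<lambda>k. (1 / 2 :: real) ^ Suc k * c)"
      by (intro summable_mult2) (simp add: summable_geometric)
    then show ?thesis using ennreal_suminf_neq_top that by (simp add: less_top)
  qed
  have "(\<integral>\<^sup>+\<omega>. ennreal (\<bar>Y 0 \<omega>\<bar> * 1) \<partial>N) = (\<Sum>k. ennreal ((1 / 2) ^ Suc k * (1 / H (t k))))"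
    using nn_abs[of "\<lambda>_. 1"] by (simp add: mono_on_def)
  also have "\<dots> \<le> (\<Sum>k. ennreal ((1 / 2) ^ Suc k * (1 / H 0)))"
    using Ht H0 by (intro suminf_le ennreal_leI mult_left_mono divide_left_mono) auto
  also have "\<dots> < \<infinity>" using H0 by (intro geom) simp
  finally have "(\<integral>\<^sup>+\<omega>. ennreal (\<bar>Y 0 \<omega>\<bar> * 1) \<partial>N) < \<infinity>" .
  then have int: "integrable N (Y 0)"
    unfolding integrable_iff_bounded by (simp only: real_norm_def mult_1_right measurable_X conj_absorb simp_thms)
  \<comment> \<open>The law is symmetric, so positive and negative parts have equal
    integrals.\<close>
  have "(\<integral>\<^sup>+\<omega>. ennreal (Y 0 \<omega>) \<partial>N) = (\<integral>\<^sup>+\<omega>. ennreal (- Y 0 \<omega>) \<partial>N)"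
    using nn[of ennreal] nn[of "\<lambda>x. ennreal (- x)"] by (simp add: add.commute)
  then have mean: "expectation (Y 0) = 0"
    unfolding real_lebesgue_integral_def[OF int] by simp
  have "(\<integral>\<^sup>+\<omega>. ennreal (\<bar>Y 0 \<omega>\<bar> * H \<bar>Y 0 \<omega>\<bar>) \<partial>N) = (\<Sum>k. ennreal ((1 / 2) ^ Suc k * 1))"
  proof -
    have "H (t k) / H (t k) = 1" for k using Ht(2)[of k] by simp
    then show ?thesis using nn_abs[OF H(2)] H(1) by (simp only: less_imp_le)
  qed
  also have "\<dots> < \<infinity>" by (rule geom) simp
  finally have A: "integrable N (\<lambda>\<omega>. \<bar>Y 0 \<omega>\<bar> * H \<bar>Y 0 \<omega>\<bar>)"
    using integrable_times_iff[OF H(1,2)] by simp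
  have "(\<Sum>k::nat. ennreal (1 / 2)) \<le> (\<Sum>k. ennreal ((1 / 2) ^ Suc k * (H (2 * t k) / H (t k))))"
  proof (intro suminf_le ennreal_leI)
    fix k
    have "2 ^ k \<le> H (2 * t k) / H (t k)" using t(2)[of k] Ht(2)[of k] by (simp add: field_simps)
    then have "(1 / 2) ^ Suc k * 2 ^ k \<le> (1 / 2) ^ Suc k * (H (2 * t k) / H (t k))" by (intro mult_left_mono) auto
    moreover have "(1 / 2 :: real) ^ Suc k * 2 ^ k = 1 / 2" by (simp add: power_divide)
    ultimately show "1 / 2 \<le> (1 / 2) ^ Suc k * (H (2 * t k) / H (t k))" by simp
  qed auto
  also have "\<dots> = (\<integral>\<^sup>+\<omega>. ennreal (\<bar>Y 0 \<omega>\<bar> * H (2 * \<bar>Y 0 \<omega>\<bar>)) \<partial>N)"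
    using H(1) by (intro nn_abs[of "\<lambda>x. H (2 * x)", symmetric]) (auto intro!: mono_onI mono_onD[OF H(2)] simp: less_imp_le)
  finally have "(\<Sum>k::nat. ennreal (1 / 2)) \<le> \<dots>" .
  moreover have "(\<Sum>k::nat. ennreal (1 / 2)) = \<infinity>"
    unfolding infinity_ennreal_def
  proof (rule summable_iff_suminf_neq_top)
    show "\<not> summable (\<lambda>_::nat. 1 / 2 :: real)" by (subst summable_const_iff) simp
  qed simp
  ultimately have "\<not> (\<integral>\<^sup>+\<omega>. ennreal (\<bar>Y 0 \<omega>\<bar> * H (2 * \<bar>Y 0 \<omega>\<bar>)) \<partial>N) < \<infinity>" by (simp add: top_unique)
  then have "\<not> (\<integral>\<^sup>+ \<omega>. Gext H (Lsup (\<lambda>n \<omega>. psum Y n \<omega> / real n) 0 (1 / 8) \<omega>) \<partial>N) < \<infinity>"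
    using nn_integral_abs_times_finite[OF H(1-3)] by blast
  with that[OF N(1,2) int mean A] show ?thesis .
qed

theorem theorem1:
  fixes M :: "'a measure" and Xs :: "nat \<Rightarrow> 'a \<Rightarrow> real" and G :: "real \<Rightarrow> real"
  assumes "prob_space M" and "iid_seq M Xs" and "moderate G"
  shows
   "((\<exists>x. G_converges_to M G (\<lambda>n \<omega>. psum Xs n \<omega> / real n) x)
        \<longleftrightarrow> integrable M (\<lambda>\<omega>. \<bar>Xs 0 \<omega>\<bar> * G \<bar>Xs 0 \<omega>\<bar>))
    \<and> ((integrable M (Xs 0) \<and> prob_space.expectation M (Xs 0) = 0) \<longrightarrow>
        ((integrable M (\<lambda>\<omega>. \<bar>Xs 0 \<omega>\<bar> * G \<bar>Xs 0 \<omega>\<bar>)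
          \<longleftrightarrow> (\<forall>a>0. summable (\<lambda>n. G (real (Suc n)) / real (Suc n) *
                  measure M {\<omega> \<in> space M. \<bar>psum Xs (Suc n) \<omega> / real (Suc n)\<bar> \<ge> a})))
        \<and> ((\<forall>a>0. summable (\<lambda>n. G (real (Suc n)) / real (Suc n) *
                  measure M {\<omega> \<in> space M. \<bar>psum Xs (Suc n) \<omega> / real (Suc n)\<bar> \<ge> a}))
          \<longleftrightarrow> (\<forall>a>0. (\<integral>\<^sup>+ \<omega>. Gext G (Lsup (\<lambda>n \<omega>. psum Xs n \<omega> / real n) 0 a \<omega>) \<partial>M) < \<infinity>))))
    \<and> (\<forall>H :: real \<Rightarrow> real.
          (\<forall>t\<ge>0. H t > 0) \<and> mono_on {0..} H \<and> filterlim H at_top at_top \<and> \<not> moderate H \<longrightarrow>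
          (\<exists>(N :: (nat \<Rightarrow> real) measure) (Ys :: nat \<Rightarrow> (nat \<Rightarrow> real) \<Rightarrow> real).
             prob_space N \<and> iid_seq N Ys \<and> integrable N (Ys 0) \<and> prob_space.expectation N (Ys 0) = 0 \<and>
             \<not> (integrable N (\<lambda>\<omega>. \<bar>Ys 0 \<omega>\<bar> * H \<bar>Ys 0 \<omega>\<bar>)
                 \<longleftrightarrow> (\<forall>a>0. (\<integral>\<^sup>+ \<omega>. Gext H (Lsup (\<lambda>n \<omega>. psum Ys n \<omega> / real n) 0 a \<omega>) \<partial>N) < \<infinity>))))"
proof -
  interpret iid_rv M Xs using assms(1,2) by (intro iid_rv.intro iid_rv_axioms.intro)
  have "\<exists>(N :: (nat \<Rightarrow> real) measure) (Ys :: nat \<Rightarrow> (nat \<Rightarrow> real) \<Rightarrow> real).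
       prob_space N \<and> iid_seq N Ys \<and> integrable N (Ys 0) \<and> prob_space.expectation N (Ys 0) = 0 \<and>
       \<not> (integrable N (\<lambda>\<omega>. \<bar>Ys 0 \<omega>\<bar> * H \<bar>Ys 0 \<omega>\<bar>)
           \<longleftrightarrow> (\<forall>a>0. (\<integral>\<^sup>+ \<omega>. Gext H (Lsup (\<lambda>n \<omega>. psum Ys n \<omega> / real n) 0 a \<omega>) \<partial>N) < \<infinity>))"
    if "(\<forall>t\<ge>0. H t > 0) \<and> mono_on {0..} H \<and> filterlim H at_top at_top \<and> \<not> moderate H" for H :: "real \<Rightarrow> real"
  proof -
    from that have H: "\<forall>t\<ge>0. H t > 0" "mono_on {0..} H" "filterlim H at_top at_top" "\<not> moderate H" by auto
    show ?thesis
    proof (rule not_moderate_counterexample[OF H])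
      fix N :: "(nat \<Rightarrow> real) measure" and Y :: "nat \<Rightarrow> (nat \<Rightarrow> real) \<Rightarrow> real"
      assume N: "prob_space N" "iid_seq N Y" "integrable N (Y 0)" "prob_space.expectation N (Y 0) = 0"
        and A: "integrable N (\<lambda>\<omega>. \<bar>Y 0 \<omega>\<bar> * H \<bar>Y 0 \<omega>\<bar>)"
        and infinite: "\<not> (\<integral>\<^sup>+ \<omega>. Gext H (Lsup (\<lambda>n \<omega>. psum Y n \<omega> / real n) 0 (1 / 8) \<omega>) \<partial>N) < \<infinity>"
      have "\<not> (integrable N (\<lambda>\<omega>. \<bar>Y 0 \<omega>\<bar> * H \<bar>Y 0 \<omega>\<bar>)
           \<longleftrightarrow> (\<forall>a>0. (\<integral>\<^sup>+ \<omega>. Gext H (Lsup (\<lambda>n \<omega>. psum Y n \<omega> / real n) 0 a \<omega>) \<partial>N) < \<infinity>))"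
      proof
        assume "integrable N (\<lambda>\<omega>. \<bar>Y 0 \<omega>\<bar> * H \<bar>Y 0 \<omega>\<bar>)
           \<longleftrightarrow> (\<forall>a>0. (\<integral>\<^sup>+ \<omega>. Gext H (Lsup (\<lambda>n \<omega>. psum Y n \<omega> / real n) 0 a \<omega>) \<partial>N) < \<infinity>)"
        from this[THEN iffD1, OF A, rule_format, of "1 / 8"] infinite show False by simp
      qed
      then show ?thesis using N by (intro exI[of _ N] exI[of _ Y] conjI)
    qed
  qed
  note counterexample = this
  show ?thesis
  proof (intro conjI impI allI, goal_cases)
    case 1
    show ?case by (rule G_converges_iff[OF assms(3)])
  next
    case 2
    then show ?case by (intro equivalences_centered(1)[OF assms(3)]) auto
  next
    case 3
    then show ?case by (intro equivalences_centered(2)[OF assms(3)]) auto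
  next
    case (4 H)
    then show ?case by (rule counterexample)
  qed
qed

end
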